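(* Let $n\ge 4$, let $M$ be a non-degenerate hypersurface in $\mathbb{A}^{n+1}$, and let $\mathcal{U}$ be the set of all points of $\mathcal{U}_{\mathrm{Ric}(R^{\ast})}\cap\mathcal{U}_{\mathrm{Weyl}(R^{\ast})}\subset M$ at which $$\mathrm{rank}(\mathrm{Ric}(R^{\ast})-\rho\,h)\ge 2\quad\text{for any }\rho\in\mathbb{R}.$$ (i) If $R^{\ast}\cdot R^{\ast}=L\,Q(h,R^{\ast})$ is satisfied on $\mathcal{U}$, where $L$ is a function on $\mathcal{U}$, then $$\mathrm{Weyl}(R^{\ast})\cdot R^{\ast}-R^{\ast}\cdot\mathrm{Weyl}(R^{\ast})=Q(\mathrm{Ric}(R^{\ast}),\mathrm{Weyl}(R^{\ast}))-\frac{\kappa(R^{\ast})}{n-1}\,Q(h,\mathrm{Weyl}(R^{\ast}))$$ and $$R^{\ast}=\frac{\phi}{2}\,(\mathrm{Ric}(R^{\ast})-L\,h)\wedge(\mathrm{Ric}(R^{\ast})-L\,h)$$ hold on $\mathcal{U}$, where $\phi$ is some function on this set. (ii) If $$R^{\ast}=\frac{\phi}{2}\,\mathrm{Ric}(R^{\ast})\wedge\mathrm{Ric}(R^{\ast})+\mu\,h\wedge\mathrm{Ric}(R^{\ast})+\frac{\eta}{2}\,h\wedge h$$ on $\mathcal{U}$, where $\phi,\mu,\eta$ are some functions on this set, then on $\mathcal{U}$ $$R^{\ast}\cdot R^{\ast}=\bigl((n-2)(\mu^{2}-\phi\eta)-\mu\bigr)\phi^{-1}\,Q(h,R^{\ast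}).$$
   Context: $\mathbb{A}^{n+1}$ is $\mathbb{R}^{n+1}$ with its standard flat connection and the volume form given by the determinant. A hypersurface $M\subset\mathbb{A}^{n+1}$ (connected, smooth) is non-degenerate if its affine fundamental form is non-degenerate; it then carries its affine normal $\xi$, the Blaschke-Berwald metric $h$ (a semi-Riemannian metric), the induced connection $\nabla$ and the affine shape operator $\mathcal{S}$ (Gauss and Weingarten formulas $\widetilde\nabla_XY=\nabla_XY+h(X,Y)\xi$, $\widetilde\nabla_X\xi=-\mathcal{S}X$); the operator $\mathcal{S}$ is $h$-self-adjoint. Set $S(X,Y)=h(X,\mathcal{S}Y)$. For symmetric $(0,2)$-tensors $E,F$ the Kulkarni-Nomizu product is $(E\wedge F)(X_1,X_2,X_3,X_4)=E(X_1,X_4)F(X_2,X_3)+E(X_2,X_3)F(X_1,X_4)-E(X_1,X_3)F(X_2,X_4)-E(X_2,X_4)F(X_1,X_3)$. The Opozda-Verstraelen affine curvature tensor is $R^{\ast}=\frac12 S\wedge S$. With $(e_j)$ an $h$-orthonormal basis, $h(e_j,e_j)=\varepsilon_j=\pm1$: $\mathrm{Ric}(R^{\ast})(X,Y)=\sum_j\varepsilon_jR^{\ast}(e_j,X,Y,e_j)$, $\kappa(R^{\ast})=\sum_j\varepsilon_j\mathrm{Ric}(R^{\ast})(e_j,e_j)$, and $\mathrm{Weyl}(R^{\ast})=R^{\ast}-\frac{1}{n-2}h\wedge\mathrm{Ric}(R^{\ast})+\frac{\kappa(R^{\ast})}{2(n-2)(n-1)}h\wedge h$. $\mathcal{U}_{\mathrm{Ric}(R^{\ast})}$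 is the set of points where $\mathrm{Ric}(R^{\ast})\ne\frac{\kappa(R^{\ast})}{n}h$; $\mathcal{U}_{\mathrm{Weyl}(R^{\ast})}$ is the set of points where $\mathrm{Weyl}(R^{\ast})\neq0$. For a $(0,4)$-tensor $B$ with the algebraic symmetries of a curvature tensor, let $\mathcal{B}(X,Y)$ be the endomorphism with $h(\mathcal{B}(X_1,X_2)X_3,X_4)=B(X_1,X_2,X_3,X_4)$. For a $(0,k)$-tensor $T$, $(B\cdot T)(X_1,\dots,X_k,X,Y)=-\sum_{i=1}^{k}T(X_1,\dots,\mathcal{B}(X,Y)X_i,\dots,X_k)$. For a symmetric $(0,2)$-tensor $A$, let $(X\wedge_AY)Z=A(Y,Z)X-A(X,Z)Y$ and $Q(A,T)(X_1,\dots,X_k,X,Y)=-\sum_{i=1}^{k}T(X_1,\dots,(X\wedge_AY)X_i,\dots,X_k)$. *)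

theory Defs
  imports "HOL-Analysis.Analysis"
begin

section \<open>Immersed hypersurfaces\<close>

text \<open>
  With \<open>n = CARD('n)\<close>, the type \<open>'n option\<close> has \<open>n + 1\<close> elements, so the type below is the
  coordinate space of dimension \<open>n + 1\<close>; its volume form is the determinant.
\<close>

type_synonym 'n affine_space = "(real, 'n option) vec"

primrec Ck_on :: "nat \<Rightarrow> ('a::euclidean_space \<Rightarrow> 'b::real_normed_vector) \<Rightarrow> 'a set \<Rightarrow> bool" where
  "Ck_on 0 f U \<longleftrightarrow> continuous_on U f"
| "Ck_on (Suc k) f U \<longleftrightarrow>
     (\<forall>x\<in>U. f differentiable at x) \<and> (\<forall>v. Ck_on k (\<lambda>x. frechet_derivative f (at x) v) U)"

definition smooth_on :: "'a set \<Rightarrow> ('a::euclidean_space \<Rightarrow> 'b::real_normed_vector) \<Rightarrow> bool" where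
  "smooth_on U f \<longleftrightarrow> (\<forall>k. Ck_on k f U)"

definition second_derivative ::
  "('a::real_normed_vector \<Rightarrow> 'b::real_normed_vector) \<Rightarrow> 'a \<Rightarrow> 'a \<Rightarrow> 'a \<Rightarrow> 'b" where
  "second_derivative f u v w =
     frechet_derivative (\<lambda>x. frechet_derivative f (at x) w) (at u) v"

text \<open>
  A hypersurface is a connected topological manifold \<open>M\<close> with a map \<open>F\<close> into the affine space
  which is a smooth immersion in suitable local parametrizations. The parametrizations for which
  \<open>F\<close> is a smooth immersion have smooth transition maps, so \<open>F\<close> determines the smooth structure.
  A subset \<open>M\<close> of the affine space is the case where \<open>F\<close> is the identity.
\<close>

definition local_param ::
  "'a::topological_space set \<Rightarrow> ('a \<Rightarrow> 'n::finite affine_space) \<Rightarrow>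
   (real ^ 'n) set \<Rightarrow> (real ^ 'n \<Rightarrow> 'a) \<Rightarrow> bool" where
  "local_param M F U \<psi> \<longleftrightarrow>
     open U \<and> openin (top_of_set M) (\<psi> ` U) \<and> (\<exists>\<phi>. homeomorphism U (\<psi> ` U) \<psi> \<phi>) \<and>
     smooth_on U (F \<circ> \<psi>) \<and> (\<forall>u\<in>U. inj (frechet_derivative (F \<circ> \<psi>) (at u)))"

definition hypersurface ::
  "'a::{t2_space, second_countable_topology} set \<Rightarrow> ('a \<Rightarrow> 'n::finite affine_space) \<Rightarrow> bool" where
  "hypersurface M F \<longleftrightarrow> connected M \<and> (\<forall>p\<in>M. \<exists>U \<psi>. local_param M F U \<psi> \<and> p \<in> \<psi> ` U)"

text \<open>The tangent space at \<open>p\<close> is identified with its image under the differential of \<open>F\<close>.\<close>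

definition tangent_space ::
  "'a::topological_space set \<Rightarrow> ('a \<Rightarrow> 'n::finite affine_space) \<Rightarrow> 'a \<Rightarrow> 'n affine_space set" where
  "tangent_space M F p =
     {frechet_derivative (F \<circ> \<psi>) (at u) v | U \<psi> u v. local_param M F U \<psi> \<and> u \<in> U \<and> \<psi> u = p}"

section \<open>The Blaschke structure\<close>

text \<open>
  Gauss formula at \<open>p\<close> with transversal vector \<open>\<zeta>\<close>: for the coordinate fields \<open>X\<close>, \<open>Y\<close> along a
  parametrization given by \<open>v\<close>, \<open>w\<close>, the flat derivative of \<open>Y\<close> in direction \<open>X\<close> is the second
  derivative of the immersion, and its difference from \<open>h(X,Y) \<zeta>\<close> is the tangential part, i.e. the
  induced covariant derivative. This determines \<open>h\<close> on tangent vectors; values on other vectors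
  are irrelevant throughout.
\<close>

definition affine_fundamental_form_at ::
  "'a::topological_space set \<Rightarrow> ('a \<Rightarrow> 'n::finite affine_space) \<Rightarrow> 'a \<Rightarrow> 'n affine_space \<Rightarrow>
   ('n affine_space \<Rightarrow> 'n affine_space \<Rightarrow> real) \<Rightarrow> bool" where
  "affine_fundamental_form_at M F p \<zeta> h \<longleftrightarrow>
     (\<forall>U \<psi> u v w. local_param M F U \<psi> \<and> u \<in> U \<and> \<psi> u = p \<longrightarrow>
        second_derivative (F \<circ> \<psi>) u v w
          - h (frechet_derivative (F \<circ> \<psi>) (at u) v) (frechet_derivative (F \<circ> \<psi>) (at u) w) *\<^sub>R \<zeta>
        \<in> tangent_space M F p)"

definition nondegenerate_on :: "'v::real_vector set \<Rightarrow> ('v \<Rightarrow> 'v \<Rightarrow> real) \<Rightarrow> bool" where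
  "nondegenerate_on T h \<longleftrightarrow> (\<forall>X\<in>T. (\<forall>Y\<in>T. h X Y = 0) \<longrightarrow> X = 0)"

text \<open>Changing the transversal vector rescales the affine fundamental form at a point.\<close>

definition nondegenerate_hypersurface ::
  "'a::{t2_space, second_countable_topology} set \<Rightarrow> ('a \<Rightarrow> 'n::finite affine_space) \<Rightarrow> bool" where
  "nondegenerate_hypersurface M F \<longleftrightarrow>
     hypersurface M F \<and>
     (\<forall>p\<in>M. \<forall>\<zeta> h. \<zeta> \<notin> tangent_space M F p \<and> affine_fundamental_form_at M F p \<zeta> h \<longrightarrow>
        nondegenerate_on (tangent_space M F p) h)"

definition transversal_field ::
  "'a::topological_space set \<Rightarrow> ('a \<Rightarrow> 'n::finite affine_space) \<Rightarrow> ('a \<Rightarrow> 'n affine_space) \<Rightarrow> bool"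
  where
  "transversal_field M F \<xi> \<longleftrightarrow>
     (\<forall>U \<psi>. local_param M F U \<psi> \<longrightarrow> smooth_on U (\<xi> \<circ> \<psi>)) \<and>
     (\<forall>p\<in>M. \<xi> p \<notin> tangent_space M F p)"

text \<open>
  The affine normal is the equiaffine transversal field for which the induced volume
  \<open>det(X\<^sub>1,\<dots>,X\<^sub>n,\<xi>)\<close> agrees, up to orientation, with the volume of its fundamental form \<open>h\<close>, which is
  then the Blaschke--Berwald metric. It is unique up to sign; both signs are admitted.
\<close>

definition affine_normal ::
  "'a::topological_space set \<Rightarrow> ('a \<Rightarrow> 'n::finite affine_space) \<Rightarrow> ('a \<Rightarrow> 'n affine_space) \<Rightarrow>
   ('a \<Rightarrow> 'n affine_space \<Rightarrow> 'n affine_space \<Rightarrow> real) \<Rightarrow> bool" where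
  "affine_normal M F \<xi> h \<longleftrightarrow>
     transversal_field M F \<xi> \<and>
     (\<forall>p\<in>M. affine_fundamental_form_at M F p (\<xi> p) (h p)) \<and>
     (\<forall>U \<psi> u v. local_param M F U \<psi> \<and> u \<in> U \<longrightarrow>
        frechet_derivative (\<xi> \<circ> \<psi>) (at u) v \<in> tangent_space M F (\<psi> u)) \<and>
     (\<forall>p\<in>M. \<forall>X :: 'n \<Rightarrow> 'n affine_space. (\<forall>i. X i \<in> tangent_space M F p) \<longrightarrow>
        \<bar>det (\<chi> r c. (case c of Some i \<Rightarrow> X i | None \<Rightarrow> \<xi> p) $ r)\<bar>
          = sqrt \<bar>det (\<chi> i j. h p (X i) (X j))\<bar>)"

text \<open>Weingarten formula.\<close>

definition affine_shape_operator ::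
  "'a::topological_space set \<Rightarrow> ('a \<Rightarrow> 'n::finite affine_space) \<Rightarrow> ('a \<Rightarrow> 'n affine_space) \<Rightarrow>
   ('a \<Rightarrow> 'n affine_space \<Rightarrow> 'n affine_space) \<Rightarrow> bool" where
  "affine_shape_operator M F \<xi> \<S> \<longleftrightarrow>
     (\<forall>U \<psi> u v. local_param M F U \<psi> \<and> u \<in> U \<longrightarrow>
        \<S> (\<psi> u) (frechet_derivative (F \<circ> \<psi>) (at u) v) \<in> tangent_space M F (\<psi> u) \<and>
        frechet_derivative (\<xi> \<circ> \<psi>) (at u) v
          = - \<S> (\<psi> u) (frechet_derivative (F \<circ> \<psi>) (at u) v))"

section \<open>Tensors on a tangent space\<close>

text \<open>
  Below, \<open>T\<close> is a tangent space and \<open>h\<close> the metric on it. Tensors are functions on the ambient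
  vectors of which only the values on \<open>T\<close> matter; they are compared on \<open>T\<close> only.
\<close>

type_synonym 'v tensor2 = "'v \<Rightarrow> 'v \<Rightarrow> real"
type_synonym 'v tensor4 = "'v \<Rightarrow> 'v \<Rightarrow> 'v \<Rightarrow> 'v \<Rightarrow> real"
type_synonym 'v tensor6 = "'v \<Rightarrow> 'v \<Rightarrow> 'v \<Rightarrow> 'v \<Rightarrow> 'v \<Rightarrow> 'v \<Rightarrow> real"

definition eq2_on :: "'v set \<Rightarrow> 'v tensor2 \<Rightarrow> 'v tensor2 \<Rightarrow> bool" where
  "eq2_on T A B \<longleftrightarrow> (\<forall>X\<in>T. \<forall>Y\<in>T. A X Y = B X Y)"

definition eq4_on :: "'v set \<Rightarrow> 'v tensor4 \<Rightarrow> 'v tensor4 \<Rightarrow> bool" where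
  "eq4_on T A B \<longleftrightarrow>
     (\<forall>X1\<in>T. \<forall>X2\<in>T. \<forall>X3\<in>T. \<forall>X4\<in>T. A X1 X2 X3 X4 = B X1 X2 X3 X4)"

definition eq6_on :: "'v set \<Rightarrow> 'v tensor6 \<Rightarrow> 'v tensor6 \<Rightarrow> bool" where
  "eq6_on T A B \<longleftrightarrow>
     (\<forall>X1\<in>T. \<forall>X2\<in>T. \<forall>X3\<in>T. \<forall>X4\<in>T. \<forall>X\<in>T. \<forall>Y\<in>T. A X1 X2 X3 X4 X Y = B X1 X2 X3 X4 X Y)"

definition kulkarni_nomizu :: "'v tensor2 \<Rightarrow> 'v tensor2 \<Rightarrow> 'v tensor4" where
  "kulkarni_nomizu E F X1 X2 X3 X4 =
     E X1 X4 * F X2 X3 + E X2 X3 * F X1 X4 - E X1 X3 * F X2 X4 - E X2 X4 * F X1 X3"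

definition curvature_endo ::
  "'v set \<Rightarrow> 'v tensor2 \<Rightarrow> 'v tensor4 \<Rightarrow> 'v \<Rightarrow> 'v \<Rightarrow> 'v \<Rightarrow> 'v" where
  "curvature_endo T h B X1 X2 X3 = (THE Z. Z \<in> T \<and> (\<forall>X4\<in>T. h Z X4 = B X1 X2 X3 X4))"

text \<open>The action of endomorphisms \<open>D X Y\<close> as derivations on a (0,4)-tensor.\<close>

definition derivation_action :: "('v \<Rightarrow> 'v \<Rightarrow> 'v \<Rightarrow> 'v) \<Rightarrow> 'v tensor4 \<Rightarrow> 'v tensor6" where
  "derivation_action D t X1 X2 X3 X4 X Y =
     - (t (D X Y X1) X2 X3 X4 + t X1 (D X Y X2) X3 X4 + t X1 X2 (D X Y X3) X4
        + t X1 X2 X3 (D X Y X4))"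

definition curvature_dot ::
  "'v set \<Rightarrow> 'v tensor2 \<Rightarrow> 'v tensor4 \<Rightarrow> 'v tensor4 \<Rightarrow> 'v tensor6" where
  "curvature_dot T h B = derivation_action (curvature_endo T h B)"

definition tachibana :: "'v::real_vector tensor2 \<Rightarrow> 'v tensor4 \<Rightarrow> 'v tensor6" where
  "tachibana A = derivation_action (\<lambda>X Y Z. A Y Z *\<^sub>R X - A X Z *\<^sub>R Y)"

definition basis_of :: "'v::real_vector set \<Rightarrow> ('n::finite \<Rightarrow> 'v) \<Rightarrow> bool" where
  "basis_of T e \<longleftrightarrow> inj e \<and> independent (range e) \<and> span (range e) = T"

definition orthonormal_basis_of ::
  "'v::real_vector set \<Rightarrow> 'v tensor2 \<Rightarrow> ('n::finite \<Rightarrow> 'v) \<Rightarrow> bool" where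
  "orthonormal_basis_of T h e \<longleftrightarrow>
     basis_of T e \<and> (\<forall>i. h (e i) (e i) = 1 \<or> h (e i) (e i) = -1) \<and>
     (\<forall>i j. i \<noteq> j \<longrightarrow> h (e i) (e j) = 0)"

text \<open>
  The next three notions do not depend on the chosen basis, which exists whenever \<open>T\<close> has
  dimension \<open>CARD('n)\<close> and \<open>h\<close> is a semi-Riemannian metric on \<open>T\<close>.
\<close>

definition tensor_rank ::
  "'n::finite affine_space set \<Rightarrow> 'n affine_space tensor2 \<Rightarrow> nat" where
  "tensor_rank T A =
     (let e = (SOME e :: 'n \<Rightarrow> 'n affine_space. basis_of T e) in rank (\<chi> i j. A (e i) (e j)))"

definition Ricci ::
  "'n::finite affine_space set \<Rightarrow> 'n affine_space tensor2 \<Rightarrow> 'n affine_space tensor4 \<Rightarrow>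
   'n affine_space tensor2" where
  "Ricci T h B X Y =
     (let e = (SOME e :: 'n \<Rightarrow> 'n affine_space. orthonormal_basis_of T h e)
      in \<Sum>j\<in>UNIV. h (e j) (e j) * B (e j) X Y (e j))"

definition scalar_curvature ::
  "'n::finite affine_space set \<Rightarrow> 'n affine_space tensor2 \<Rightarrow> 'n affine_space tensor4 \<Rightarrow> real" where
  "scalar_curvature T h B =
     (let e = (SOME e :: 'n \<Rightarrow> 'n affine_space. orthonormal_basis_of T h e)
      in \<Sum>j\<in>UNIV. h (e j) (e j) * Ricci T h B (e j) (e j))"

definition Weyl ::
  "'n::finite affine_space set \<Rightarrow> 'n affine_space tensor2 \<Rightarrow> 'n affine_space tensor4 \<Rightarrow>
   'n affine_space tensor4" where
  "Weyl T h B X1 X2 X3 X4 =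
     (let n = real CARD('n) in
        B X1 X2 X3 X4 - 1 / (n - 2) * kulkarni_nomizu h (Ricci T h B) X1 X2 X3 X4
          + scalar_curvature T h B / (2 * (n - 2) * (n - 1)) * kulkarni_nomizu h h X1 X2 X3 X4)"

section \<open>The Opozda--Verstraelen affine curvature tensor\<close>

definition OV_curvature :: "'v tensor2 \<Rightarrow> ('v \<Rightarrow> 'v) \<Rightarrow> 'v tensor4" where
  "OV_curvature h \<S> X1 X2 X3 X4 =
     1 / 2 * kulkarni_nomizu (\<lambda>X Y. h X (\<S> Y)) (\<lambda>X Y. h X (\<S> Y)) X1 X2 X3 X4"

definition U_Ricci ::
  "'a::topological_space set \<Rightarrow> ('a \<Rightarrow> 'n::finite affine_space) \<Rightarrow>
   ('a \<Rightarrow> 'n affine_space tensor2) \<Rightarrow> ('a \<Rightarrow> 'n affine_space tensor4) \<Rightarrow> 'a set" where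
  "U_Ricci M F h R =
     {p \<in> M. \<not> eq2_on (tangent_space M F p)
        (Ricci (tangent_space M F p) (h p) (R p))
        (\<lambda>X Y. scalar_curvature (tangent_space M F p) (h p) (R p) / real CARD('n) * h p X Y)}"

definition U_Weyl ::
  "'a::topological_space set \<Rightarrow> ('a \<Rightarrow> 'n::finite affine_space) \<Rightarrow>
   ('a \<Rightarrow> 'n affine_space tensor2) \<Rightarrow> ('a \<Rightarrow> 'n affine_space tensor4) \<Rightarrow> 'a set" where
  "U_Weyl M F h R =
     {p \<in> M. \<not> eq4_on (tangent_space M F p)
        (Weyl (tangent_space M F p) (h p) (R p)) (\<lambda>X1 X2 X3 X4. 0)}"

end

theory Submission
  imports Defs
begin

text \<open>
  Everything happens in one tangent space, with \<open>R = (1/2) S \<and> S\<close>. There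
  \<open>R \<cdot> R = S \<and> (R \<cdot> S)\<close> and \<open>Q(h, R) = S \<and> Q(h, S)\<close>. If \<open>S\<close> has rank at least three, \<open>S\<close> can be
  cancelled from \<open>S \<and> (R \<cdot> S - L Q(h, S)) = 0\<close>; this gives a quadratic equation
  \<open>\<S>\<^sup>2 = c \<S> - L\<close>, whence \<open>Ric - L h\<close> is a nonzero multiple of \<open>S\<close>. If the rank is at
  most two, then \<open>R \<cdot> R = 0\<close>, so \<open>L = 0\<close> because \<open>Q(h, R) = 0\<close> would make the point Einstein, and
  \<open>Ric \<and> Ric\<close> is a multiple of \<open>S \<and> S\<close>, nonzero by the rank hypothesis with \<open>\<rho> = 0\<close>.

  If \<open>R\<close> is a combination of \<open>Ric \<and> Ric\<close>, \<open>h \<and> Ric\<close> and \<open>h \<and> h\<close>, contraction yields a quadratic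
  equation for the Ricci operator (the leading coefficient is nonzero since \<open>Weyl(R) \<noteq> 0\<close>). Then all
  tensors \<open>B \<cdot> t\<close>, \<open>Q(h, t)\<close>, \<open>Q(Ric, t)\<close> with \<open>B\<close>, \<open>t\<close> among \<open>R\<close>, \<open>Weyl(R)\<close> are combinations of
  \<open>Ric \<and> Q(h, Ric)\<close> and \<open>h \<and> Q(h, Ric)\<close>, and the claimed identities follow by comparing coefficients.

  The symmetry of \<open>h\<close> and the self-adjointness of \<open>\<S>\<close> come from the symmetry of the second
  derivatives of the immersion and of the affine normal.
\<close>

section \<open>Tensors in a semi-Riemannian vector space\<close>

definition derivation2 :: "('v \<Rightarrow> 'v) \<Rightarrow> 'v tensor2 \<Rightarrow> 'v tensor2" where
  "derivation2 D E X Y = - (E (D X) Y + E X (D Y))"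

text \<open>\<open>eq4_on\<close> compares tensors on \<open>T\<close> only, so the derivation has
  to map \<open>T\<close> into itself.\<close>

lemma derivation_action_cong:
  assumes "eq4_on T t t'" and "\<And>Z. Z \<in> T \<Longrightarrow> D X Y Z \<in> T"
    and "X1 \<in> T" "X2 \<in> T" "X3 \<in> T" "X4 \<in> T"
  shows "derivation_action D t X1 X2 X3 X4 X Y = derivation_action D t' X1 X2 X3 X4 X Y"
  using assms by (simp add: derivation_action_def eq4_on_def)

text \<open>The curvature tensor, its Weyl part and the hypothesis of part (ii) all have this shape, with
  \<open>a\<close> the Ricci tensor.\<close>

definition quadratic_tensor ::
  "'v tensor2 \<Rightarrow> 'v tensor2 \<Rightarrow> real \<Rightarrow> real \<Rightarrow> real \<Rightarrow> 'v tensor4" where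
  "quadratic_tensor h a \<phi> \<mu> \<eta> X1 X2 X3 X4 =
     \<phi> / 2 * kulkarni_nomizu a a X1 X2 X3 X4 + \<mu> * kulkarni_nomizu h a X1 X2 X3 X4
     + \<eta> / 2 * kulkarni_nomizu h h X1 X2 X3 X4"

text \<open>Leibniz rule for the Kulkarni-Nomizu product. That product is symmetric in its two
  factors, which absorbs the halves in front of the squares.\<close>

lemma derivation_action_quadratic_tensor:
  "derivation_action D (quadratic_tensor h a \<phi> \<mu> \<eta>) X1 X2 X3 X4 X Y =
     \<phi> * kulkarni_nomizu a (derivation2 (D X Y) a) X1 X2 X3 X4
     + \<mu> * (kulkarni_nomizu h (derivation2 (D X Y) a) X1 X2 X3 X4
          + kulkarni_nomizu a (derivation2 (D X Y) h) X1 X2 X3 X4)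
     + \<eta> * kulkarni_nomizu h (derivation2 (D X Y) h) X1 X2 X3 X4"
  by (simp add: derivation_action_def kulkarni_nomizu_def derivation2_def quadratic_tensor_def
      algebra_simps)

lemma kulkarni_nomizu_cong:
  assumes "eq2_on T E E'" "eq2_on T F F'" "X1 \<in> T" "X2 \<in> T" "X3 \<in> T" "X4 \<in> T"
  shows "kulkarni_nomizu E F X1 X2 X3 X4 = kulkarni_nomizu E' F' X1 X2 X3 X4"
  using assms by (simp add: kulkarni_nomizu_def eq2_on_def)

text \<open>\<open>wedge_action h a X Y\<close> is \<open>Q(h, a)(\<cdot>, \<cdot>, X, Y)\<close>.\<close>

definition wedge_action :: "'v tensor2 \<Rightarrow> 'v tensor2 \<Rightarrow> 'v \<Rightarrow> 'v \<Rightarrow> 'v tensor2" where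
  "wedge_action h a X Y Z W =
     - (h Y Z * a X W - h X Z * a Y W + h Y W * a X Z - h X W * a Y Z)"

text \<open>The frame is a parameter, so that traces are finite sums over \<open>'n\<close>. Its
  existence carries the nondegeneracy of \<open>h\<close>, and symmetry transfers linearity to the
  second slot.\<close>

locale semi_riemannian_frame =
  fixes T :: "'v::real_vector set" and h :: "'v tensor2" and e :: "'n::finite \<Rightarrow> 'v"
  assumes orthonormal: "orthonormal_basis_of T h e"
    and metric_commute: "\<And>X Y. X \<in> T \<Longrightarrow> Y \<in> T \<Longrightarrow> h X Y = h Y X"
    and metric_add: "\<And>X Y Z. X \<in> T \<Longrightarrow> Y \<in> T \<Longrightarrow> Z \<in> T \<Longrightarrow> h (X + Y) Z = h X Z + h Y Z"
    and metric_scale: "\<And>c X Z. X \<in> T \<Longrightarrow> Z \<in> T \<Longrightarrow> h (c *\<^sub>R X) Z = c * h X Z"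
begin

lemma subspace_T: "subspace T"
  using orthonormal unfolding orthonormal_basis_of_def basis_of_def by (metis subspace_span)

lemma frame_in [simp]: "e j \<in> T"
  using orthonormal unfolding orthonormal_basis_of_def basis_of_def by (metis rangeI span_base)

lemma add_in [simp]: "X \<in> T \<Longrightarrow> Y \<in> T \<Longrightarrow> X + Y \<in> T"
  and diff_in [simp]: "X \<in> T \<Longrightarrow> Y \<in> T \<Longrightarrow> X - Y \<in> T"
  and scale_in [simp]: "X \<in> T \<Longrightarrow> c *\<^sub>R X \<in> T"
  and zero_in [simp]: "0 \<in> T"
  using subspace_T by (auto intro: subspace_add subspace_diff subspace_scale subspace_0)

lemma sum_in: "(\<And>i. x i \<in> T) \<Longrightarrow> (\<Sum>i\<in>I. x i) \<in> T"
  using subspace_T by (auto intro: subspace_sum)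

lemma metric_diff: "X \<in> T \<Longrightarrow> Y \<in> T \<Longrightarrow> Z \<in> T \<Longrightarrow> h (X - Y) Z = h X Z - h Y Z"
  using metric_add[of X "(-1) *\<^sub>R Y" Z] metric_scale[of Y Z "-1"] scale_in[of Y "-1"] by simp

lemma metric_zero: "Z \<in> T \<Longrightarrow> h 0 Z = 0"
  using metric_scale[of 0 Z 0] by simp

lemma metric_add_right: "X \<in> T \<Longrightarrow> Y \<in> T \<Longrightarrow> Z \<in> T \<Longrightarrow> h Z (X + Y) = h Z X + h Z Y"
  and metric_diff_right: "X \<in> T \<Longrightarrow> Y \<in> T \<Longrightarrow> Z \<in> T \<Longrightarrow> h Z (X - Y) = h Z X - h Z Y"
  and metric_scale_right: "X \<in> T \<Longrightarrow> Z \<in> T \<Longrightarrow> h Z (c *\<^sub>R X) = c * h Z X"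
  by (simp_all add: metric_commute[of Z] metric_add metric_scale metric_diff)

lemmas metric_bilinear = metric_add metric_add_right metric_diff metric_diff_right
  metric_scale metric_scale_right

lemma metric_sum:
  assumes "\<And>i. x i \<in> T" "Z \<in> T" "finite I"
  shows "h (\<Sum>i\<in>I. c i *\<^sub>R x i) Z = (\<Sum>i\<in>I. c i * h (x i) Z)"
  using \<open>finite I\<close>
  by (induction I) (simp_all add: metric_zero metric_add metric_scale assms sum_in)

lemma frame_sign: "h (e j) (e j) * h (e j) (e j) = 1"
  using orthonormal unfolding orthonormal_basis_of_def by (metis mult_1 mult_minus1 minus_minus)

lemma frame_orthogonal: "i \<noteq> j \<Longrightarrow> h (e i) (e j) = 0"
  using orthonormal unfolding orthonormal_basis_of_def by blast

lemma metric_frame_combination: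
  "h (\<Sum>j\<in>UNIV. c j *\<^sub>R e j) (e i) = c i * h (e i) (e i)"
proof -
  have "h (\<Sum>j\<in>UNIV. c j *\<^sub>R e j) (e i) = (\<Sum>j\<in>UNIV. c j * h (e j) (e i))"
    by (rule metric_sum) auto
  also have "\<dots> = (\<Sum>j\<in>UNIV. if j = i then c i * h (e i) (e i) else 0)"
    by (rule sum.cong) (auto simp: frame_orthogonal)
  finally show ?thesis by simp
qed

text \<open>The sign \<open>h (e j) (e j)\<close> is its own inverse, so multiplying by it replaces
  the division by the squared length of \<open>e j\<close>.\<close>

lemma frame_expansion:
  assumes "X \<in> T"
  shows "X = (\<Sum>j\<in>UNIV. (h (e j) (e j) * h X (e j)) *\<^sub>R e j)"
proof -
  have "X \<in> span (range e)" and inj: "inj e"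
    using assms orthonormal unfolding orthonormal_basis_of_def basis_of_def by auto
  then obtain u where "X = (\<Sum>v\<in>range e. u v *\<^sub>R v)"
    by (auto simp: span_finite)
  then have X: "X = (\<Sum>j\<in>UNIV. u (e j) *\<^sub>R e j)"
    using inj by (simp add: sum.reindex)
  have "h (e j) (e j) * h X (e j) = u (e j)" for j
    using X metric_frame_combination[of "\<lambda>j. u (e j)" j] frame_sign[of j]
    by (metis mult.left_commute mult.right_neutral)
  then show ?thesis using X by simp
qed

text \<open>Contractions below are reduced to this formula: a frame vector that occurs twice,
  weighted by its sign, is summed away.\<close>

lemma metric_contraction:
  assumes "X \<in> T" "Y \<in> T"
  shows "(\<Sum>j\<in>UNIV. h (e j) (e j) * (h X (e j) * h (e j) Y)) = h X Y"
proof -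
  have "h X Y = h (\<Sum>j\<in>UNIV. (h (e j) (e j) * h X (e j)) *\<^sub>R e j) Y"
    using frame_expansion[OF assms(1)] by simp
  also have "\<dots> = (\<Sum>j\<in>UNIV. (h (e j) (e j) * h X (e j)) * h (e j) Y)"
    by (rule metric_sum) (auto simp: assms)
  finally show ?thesis by (simp add: mult.assoc)
qed

lemma metric_nondegenerate:
  assumes "X \<in> T" "\<And>Y. Y \<in> T \<Longrightarrow> h X Y = 0"
  shows "X = 0"
  using frame_expansion[OF assms(1)] assms(2) by simp

lemma metric_eqI:
  assumes "X \<in> T" "Y \<in> T" "\<And>Z. Z \<in> T \<Longrightarrow> h X Z = h Y Z"
  shows "X = Y"
  using metric_nondegenerate[of "X - Y"] assms by (simp add: metric_diff)

text \<open>The representing vector is the functional with its index raised along the frame.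
  Uniqueness is included because \<open>curvature_endo\<close> is a definite description.\<close>

lemma riesz:
  assumes add: "\<And>X Y. X \<in> T \<Longrightarrow> Y \<in> T \<Longrightarrow> f (X + Y) = f X + f Y"
    and scale: "\<And>c X. X \<in> T \<Longrightarrow> f (c *\<^sub>R X) = c * (f X :: real)"
  shows "\<exists>!Z. Z \<in> T \<and> (\<forall>X\<in>T. h Z X = f X)"
proof -
  have f0: "f 0 = 0" using scale[of 0 0] by simp
  have fsum: "f (\<Sum>i\<in>I. c i *\<^sub>R x i) = (\<Sum>i\<in>I. c i * f (x i))"
    if "\<And>i. x i \<in> T" "finite I" for c x and I :: "'n set"
    using that(2) by (induction I) (simp_all add: f0 add scale that sum_in)
  define Z where "Z = (\<Sum>j\<in>UNIV. (h (e j) (e j) * f (e j)) *\<^sub>R e j)"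
  have Z: "Z \<in> T" unfolding Z_def by (rule sum_in) simp
  have "h Z X = f X" if X: "X \<in> T" for X
  proof -
    have "h Z X = (\<Sum>j\<in>UNIV. (h (e j) (e j) * f (e j)) * h (e j) X)"
      unfolding Z_def by (rule metric_sum) (auto simp: X)
    also have "\<dots> = (\<Sum>j\<in>UNIV. (h (e j) (e j) * h X (e j)) * f (e j))"
      by (rule sum.cong) (auto simp: X metric_commute)
    also have "\<dots> = f (\<Sum>j\<in>UNIV. (h (e j) (e j) * h X (e j)) *\<^sub>R e j)"
      by (rule fsum[symmetric]) auto
    also have "\<dots> = f X" using frame_expansion[OF X] by simp
    finally show ?thesis .
  qed
  then show ?thesis using Z metric_eqI by (intro ex1I[of _ Z]) auto
qed

lemma curvature_endo:
  assumes "\<And>Y Z. Y \<in> T \<Longrightarrow> Z \<in> T \<Longrightarrow> B X1 X2 X3 (Y + Z) = B X1 X2 X3 Y + B X1 X2 X3 Z"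
    and "\<And>c Y. Y \<in> T \<Longrightarrow> B X1 X2 X3 (c *\<^sub>R Y) = c * B X1 X2 X3 Y"
  shows "curvature_endo T h B X1 X2 X3 \<in> T"
    and "X4 \<in> T \<Longrightarrow> h (curvature_endo T h B X1 X2 X3) X4 = B X1 X2 X3 X4"
  using theI'[OF riesz[of "B X1 X2 X3", OF assms]] unfolding curvature_endo_def by auto

lemma curvature_endo_cong:
  assumes "eq4_on T B B'" "X1 \<in> T" "X2 \<in> T" "X3 \<in> T"
  shows "curvature_endo T h B X1 X2 X3 = curvature_endo T h B' X1 X2 X3"
proof -
  have "(Z \<in> T \<and> (\<forall>X4\<in>T. h Z X4 = B X1 X2 X3 X4)) = (Z \<in> T \<and> (\<forall>X4\<in>T. h Z X4 = B' X1 X2 X3 X4))" for Z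
    using assms unfolding eq4_on_def by auto
  then show ?thesis unfolding curvature_endo_def by simp
qed

end

section \<open>Derivations of tensors built from the metric and a self-adjoint operator\<close>

locale self_adjoint_frame = semi_riemannian_frame T h e
  for T :: "'v::real_vector set" and h :: "'v tensor2" and e :: "'n::finite \<Rightarrow> 'v" +
  fixes A :: "'v \<Rightarrow> 'v"
  assumes operator_in [simp]: "X \<in> T \<Longrightarrow> A X \<in> T"
    and self_adjoint: "X \<in> T \<Longrightarrow> Y \<in> T \<Longrightarrow> h X (A Y) = h Y (A X)"
begin

abbreviation form :: "'v tensor2" where
  "form \<equiv> \<lambda>X Y. h X (A Y)"

lemma form_commute: "X \<in> T \<Longrightarrow> Y \<in> T \<Longrightarrow> h (A X) Y = h X (A Y)"
  by (simp add: self_adjoint metric_commute)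

lemma form_add: "X \<in> T \<Longrightarrow> Y \<in> T \<Longrightarrow> Z \<in> T \<Longrightarrow> h Z (A (X + Y)) = h Z (A X) + h Z (A Y)"
  and form_diff: "X \<in> T \<Longrightarrow> Y \<in> T \<Longrightarrow> Z \<in> T \<Longrightarrow> h Z (A (X - Y)) = h Z (A X) - h Z (A Y)"
  and form_scale: "X \<in> T \<Longrightarrow> Z \<in> T \<Longrightarrow> h Z (A (c *\<^sub>R X)) = c * h Z (A X)"
  by (simp_all add: self_adjoint[of Z] metric_bilinear)

lemmas form_bilinear = form_add form_diff form_scale

lemma quadratic_tensor_linear:
  assumes "X1 \<in> T" "X2 \<in> T" "X3 \<in> T"
  shows "Y \<in> T \<Longrightarrow> Z \<in> T \<Longrightarrow> quadratic_tensor h form \<phi> \<mu> \<eta> X1 X2 X3 (Y + Z) =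
      quadratic_tensor h form \<phi> \<mu> \<eta> X1 X2 X3 Y + quadratic_tensor h form \<phi> \<mu> \<eta> X1 X2 X3 Z"
    and "Y \<in> T \<Longrightarrow> quadratic_tensor h form \<phi> \<mu> \<eta> X1 X2 X3 (c *\<^sub>R Y) =
      c * quadratic_tensor h form \<phi> \<mu> \<eta> X1 X2 X3 Y"
  using assms
  by (simp_all add: quadratic_tensor_def kulkarni_nomizu_def metric_bilinear form_bilinear
      algebra_simps)

lemma quadratic_endo:
  assumes B: "eq4_on T B (quadratic_tensor h form \<phi> \<mu> \<eta>)" and "X \<in> T" "Y \<in> T" "Z \<in> T"
  shows "curvature_endo T h B X Y Z \<in> T"
    and "W \<in> T \<Longrightarrow> h (curvature_endo T h B X Y Z) W = quadratic_tensor h form \<phi> \<mu> \<eta> X Y Z W"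
  unfolding curvature_endo_cong[OF assms]
  by (rule curvature_endo; use assms in \<open>simp add: quadratic_tensor_linear\<close>)+

text \<open>A \<open>quadratic_tensor\<close> is skew in its last two slots, so its endomorphisms
  are skew for \<open>h\<close>.\<close>

lemma derivation2_metric_quadratic_endo:
  assumes B: "eq4_on T B (quadratic_tensor h form \<phi> \<mu> \<eta>)" and "X \<in> T" "Y \<in> T" "Z \<in> T" "W \<in> T"
  shows "derivation2 (curvature_endo T h B X Y) h Z W = 0"
  using assms metric_commute[OF \<open>Z \<in> T\<close> quadratic_endo(1)[OF B, of X Y W]]
  by (simp add: derivation2_def quadratic_endo[OF B] quadratic_tensor_def kulkarni_nomizu_def
      algebra_simps)

text \<open>The derivation is moved onto the metric: \<open>a(\<B>(X,Y)Z, W) = h(\<B>(X,Y)Z, A W) = B(X,Y,Z,A W)\<close>.\<close>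

lemma derivation2_form_quadratic_endo:
  assumes B: "eq4_on T B (quadratic_tensor h form \<phi> \<mu> \<eta>)" and "X \<in> T" "Y \<in> T" "Z \<in> T" "W \<in> T"
  shows "derivation2 (curvature_endo T h B X Y) form Z W =
    - (quadratic_tensor h form \<phi> \<mu> \<eta> X Y Z (A W) + quadratic_tensor h form \<phi> \<mu> \<eta> X Y W (A Z))"
  using assms self_adjoint[OF \<open>Z \<in> T\<close> quadratic_endo(1)[OF B, of X Y W]]
  by (simp add: derivation2_def quadratic_endo[OF B])

text \<open>After the square of \<open>A\<close> is substituted, every term that is skew in
  \<open>Z\<close> and \<open>W\<close> cancels on symmetrization. What survives is a multiple of
  \<open>Q(h, a)\<close>: the parts \<open>a \<and> a\<close>, \<open>h \<and> a\<close>,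
  \<open>h \<and> h\<close> of \<open>B\<close> contribute \<open>- \<phi> * \<beta>\<close>,
  \<open>\<mu> * \<alpha>\<close> and \<open>\<eta>\<close>.\<close>

lemma derivation2_form_quadratic:
  assumes B: "eq4_on T B (quadratic_tensor h form \<phi> \<mu> \<eta>)" and T: "X \<in> T" "Y \<in> T" "Z \<in> T" "W \<in> T"
    and square: "\<And>X Y. X \<in> T \<Longrightarrow> Y \<in> T \<Longrightarrow> h X (A (A Y)) = \<alpha> * h X (A Y) + \<beta> * h X Y"
  shows "derivation2 (curvature_endo T h B X Y) form Z W =
    (\<mu> * \<alpha> + \<eta> - \<phi> * \<beta>) * wedge_action h form X Y Z W"
  unfolding derivation2_form_quadratic_endo[OF B T]
  by (simp add: quadratic_tensor_def kulkarni_nomizu_def wedge_action_def T square algebra_simps)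

text \<open>Since \<open>B \<cdot> h = 0\<close>, only the factors \<open>a\<close> of
  \<open>t\<close> are differentiated and its \<open>h \<and> h\<close> part drops out.\<close>

lemma curvature_dot_quadratic:
  assumes B: "eq4_on T B (quadratic_tensor h form \<phi> \<mu> \<eta>)"
    and t: "eq4_on T t (quadratic_tensor h form \<phi>' \<mu>' \<eta>')"
    and square: "\<And>X Y. X \<in> T \<Longrightarrow> Y \<in> T \<Longrightarrow> h X (A (A Y)) = \<alpha> * h X (A Y) + \<beta> * h X Y"
    and T: "X1 \<in> T" "X2 \<in> T" "X3 \<in> T" "X4 \<in> T" "X \<in> T" "Y \<in> T"
  shows "curvature_dot T h B t X1 X2 X3 X4 X Y = (\<mu> * \<alpha> + \<eta> - \<phi> * \<beta>) *
    (\<phi>' * kulkarni_nomizu form (wedge_action h form X Y) X1 X2 X3 X4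
     + \<mu>' * kulkarni_nomizu h (wedge_action h form X Y) X1 X2 X3 X4)"
proof -
  let ?D = "curvature_endo T h B"
  have "curvature_dot T h B t X1 X2 X3 X4 X Y =
      derivation_action ?D (quadratic_tensor h form \<phi>' \<mu>' \<eta>') X1 X2 X3 X4 X Y"
    unfolding curvature_dot_def
    by (rule derivation_action_cong[OF t]) (use T quadratic_endo(1)[OF B] in auto)
  then show ?thesis
    unfolding derivation_action_quadratic_tensor
    by (simp add: kulkarni_nomizu_def derivation2_form_quadratic[OF B _ _ _ _ square]
        derivation2_metric_quadratic_endo[OF B] T algebra_simps)
qed

text \<open>The rules \<open>Q(h, h) = 0\<close>, \<open>Q(a, a) = 0\<close> and
  \<open>Q(a, h) = - Q(h, a)\<close>, from which every Tachibana tensor below is computed.\<close>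

lemma derivation2_wedge_metric:
  assumes "X \<in> T" "Y \<in> T" "Z \<in> T" "W \<in> T"
  shows "derivation2 (\<lambda>Z. h Y Z *\<^sub>R X - h X Z *\<^sub>R Y) form Z W = wedge_action h form X Y Z W"
    and "derivation2 (\<lambda>Z. h Y Z *\<^sub>R X - h X Z *\<^sub>R Y) h Z W = 0"
    and "derivation2 (\<lambda>Z. form Y Z *\<^sub>R X - form X Z *\<^sub>R Y) form Z W = 0"
    and "derivation2 (\<lambda>Z. form Y Z *\<^sub>R X - form X Z *\<^sub>R Y) h Z W = - wedge_action h form X Y Z W"
  using assms
  by (simp_all add: derivation2_def wedge_action_def metric_bilinear form_bilinear
      metric_commute[of Z X] metric_commute[of Z Y] self_adjoint[of Z X] self_adjoint[of Z Y]
      algebra_simps)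

lemma tachibana_metric_quadratic:
  assumes t: "eq4_on T t (quadratic_tensor h form \<phi> \<mu> \<eta>)"
    and T: "X1 \<in> T" "X2 \<in> T" "X3 \<in> T" "X4 \<in> T" "X \<in> T" "Y \<in> T"
  shows "tachibana h t X1 X2 X3 X4 X Y =
    \<phi> * kulkarni_nomizu form (wedge_action h form X Y) X1 X2 X3 X4
     + \<mu> * kulkarni_nomizu h (wedge_action h form X Y) X1 X2 X3 X4"
proof -
  have "tachibana h t X1 X2 X3 X4 X Y =
      derivation_action (\<lambda>X Y Z. h Y Z *\<^sub>R X - h X Z *\<^sub>R Y)
        (quadratic_tensor h form \<phi> \<mu> \<eta>) X1 X2 X3 X4 X Y"
    unfolding tachibana_def by (rule derivation_action_cong[OF t]) (use T in auto)
  then show ?thesis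
    unfolding derivation_action_quadratic_tensor
    by (simp add: kulkarni_nomizu_def derivation2_wedge_metric T algebra_simps)
qed

text \<open>Now the factors \<open>a\<close> are constant and \<open>h\<close> is differentiated.
  Hence the coefficients shift: \<open>\<mu>\<close> and \<open>\<eta>\<close> stand, with a sign,
  where \<open>\<phi>\<close> and \<open>\<mu>\<close> stood for \<open>Q(h, t)\<close>.\<close>

lemma tachibana_form_quadratic:
  assumes t: "eq4_on T t (quadratic_tensor h form \<phi> \<mu> \<eta>)"
    and a: "eq2_on T a form"
    and T: "X1 \<in> T" "X2 \<in> T" "X3 \<in> T" "X4 \<in> T" "X \<in> T" "Y \<in> T"
  shows "tachibana a t X1 X2 X3 X4 X Y =
    - \<mu> * kulkarni_nomizu form (wedge_action h form X Y) X1 X2 X3 X4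
     - \<eta> * kulkarni_nomizu h (wedge_action h form X Y) X1 X2 X3 X4"
proof -
  have "tachibana a t X1 X2 X3 X4 X Y = tachibana form t X1 X2 X3 X4 X Y"
    using a T by (simp add: tachibana_def derivation_action_def eq2_on_def)
  also have "\<dots> = derivation_action (\<lambda>X Y Z. form Y Z *\<^sub>R X - form X Z *\<^sub>R Y)
        (quadratic_tensor h form \<phi> \<mu> \<eta>) X1 X2 X3 X4 X Y"
    unfolding tachibana_def by (rule derivation_action_cong[OF t]) (use T in auto)
  finally show ?thesis
    unfolding derivation_action_quadratic_tensor
    by (simp add: kulkarni_nomizu_def derivation2_wedge_metric T algebra_simps)
qed

section \<open>Traces over the frame\<close>

definition trace :: real where
  "trace = (\<Sum>j\<in>UNIV. h (e j) (e j) * form (e j) (e j))"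

text \<open>This contraction uses the fixed frame \<open>e\<close>, whereas \<open>Ricci\<close>
  chooses a frame; \<open>OV_point\<close> makes the two frames equal.\<close>

definition Ricci_trace :: "'v tensor4 \<Rightarrow> 'v tensor2" where
  "Ricci_trace B X Y = (\<Sum>j\<in>UNIV. h (e j) (e j) * B (e j) X Y (e j))"

lemma Ricci_trace_cong:
  assumes "eq4_on T B B'" "X \<in> T" "Y \<in> T"
  shows "Ricci_trace B X Y = Ricci_trace B' X Y"
  using assms by (simp add: Ricci_trace_def eq4_on_def)

text \<open>In each product, either both frame vectors enter the same factor, giving
  \<open>trace\<close> or the dimension, or they link two factors and
  \<open>metric_contraction\<close> applies.\<close>

lemma Ricci_trace_quadratic:
  assumes T: "X \<in> T" "Y \<in> T"
  shows "Ricci_trace (quadratic_tensor h form \<phi> \<mu> \<eta>) X Y =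
    \<phi> * (trace * form X Y - form X (A Y))
    + \<mu> * (real CARD('n) * form X Y + trace * h X Y - 2 * form X Y)
    + \<eta> * (real CARD('n) - 1) * h X Y"
proof -
  have aa: "(\<Sum>j\<in>UNIV. h (e j) (e j) * (h (A X) (e j) * h (e j) (A Y))) = form X (A Y)"
    using metric_contraction[of "A X" "A Y"] T by (simp add: form_commute)
  have ha: "(\<Sum>j\<in>UNIV. h (e j) (e j) * (h X (e j) * h (e j) (A Y))) = form X Y"
    using metric_contraction[of X "A Y"] T by simp
  have ah: "(\<Sum>j\<in>UNIV. h (e j) (e j) * (h (A X) (e j) * h (e j) Y)) = form X Y"
    using metric_contraction[of "A X" Y] T by (simp add: form_commute)
  have hh: "(\<Sum>j\<in>UNIV. h (e j) (e j) * (h X (e j) * h (e j) Y)) = h X Y"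
    using metric_contraction[of X Y] T by simp
  have "Ricci_trace (quadratic_tensor h form \<phi> \<mu> \<eta>) X Y = (\<Sum>j\<in>UNIV.
     \<phi> * (form X Y * (h (e j) (e j) * form (e j) (e j)))
     - \<phi> * (h (e j) (e j) * (h (A X) (e j) * h (e j) (A Y)))
     + \<mu> * (form X Y * (h (e j) (e j) * h (e j) (e j)) + h X Y * (h (e j) (e j) * form (e j) (e j)))
     - \<mu> * (h (e j) (e j) * (h X (e j) * h (e j) (A Y)))
     - \<mu> * (h (e j) (e j) * (h (A X) (e j) * h (e j) Y))
     + \<eta> * (h X Y * (h (e j) (e j) * h (e j) (e j)))
     - \<eta> * (h (e j) (e j) * (h X (e j) * h (e j) Y)))"
    unfolding Ricci_trace_def
    by (rule sum.cong)
       (auto simp: quadratic_tensor_def kulkarni_nomizu_def T form_commute algebra_simps)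
  also have "\<dots> = \<phi> * (form X Y * trace) - \<phi> * form X (A Y)
     + \<mu> * (form X Y * real CARD('n) + h X Y * trace) - \<mu> * form X Y - \<mu> * form X Y
     + \<eta> * (h X Y * real CARD('n)) - \<eta> * h X Y"
    unfolding sum.distrib sum_subtractf sum_distrib_left[symmetric] aa ha ah hh
    by (simp add: frame_sign trace_def flip: sum_distrib_left)
  finally show ?thesis by (simp add: algebra_simps)
qed

end

section \<open>Minors of bilinear forms and the cancellation of a Kulkarni-Nomizu factor\<close>

definition minor2 :: "'v tensor2 \<Rightarrow> 'v tensor4" where
  "minor2 s X1 X2 Y1 Y2 = s X1 Y1 * s X2 Y2 - s X1 Y2 * s X2 Y1"

text \<open>Expansion along the first row. Conditions on the rank of a form are expressed by minors
  at arbitrary vectors, which avoids matrices.\<close>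

definition minor3 :: "'v tensor2 \<Rightarrow> 'v tensor6" where
  "minor3 s X1 X2 X3 Y1 Y2 Y3 =
     s X1 Y1 * minor2 s X2 X3 Y2 Y3 - s X1 Y2 * minor2 s X2 X3 Y1 Y3 + s X1 Y3 * minor2 s X2 X3 Y1 Y2"

text \<open>The witnesses are the entries of the adjugate divided by the determinant, listed column
  by column.\<close>

lemma inverse_matrix_3:
  fixes m11 :: real
  assumes "m11 * (m22 * m33 - m23 * m32) - m12 * (m21 * m33 - m23 * m31)
      + m13 * (m21 * m32 - m22 * m31) \<noteq> 0" (is "?d \<noteq> 0")
  shows "\<exists>c11 c21 c31 c12 c22 c32 c13 c23 c33.
      c11 * m11 + c21 * m12 + c31 * m13 = 1 \<and> c12 * m11 + c22 * m12 + c32 * m13 = 0 \<and>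
      c13 * m11 + c23 * m12 + c33 * m13 = 0 \<and>
      c11 * m21 + c21 * m22 + c31 * m23 = 0 \<and> c12 * m21 + c22 * m22 + c32 * m23 = 1 \<and>
      c13 * m21 + c23 * m22 + c33 * m23 = 0 \<and>
      c11 * m31 + c21 * m32 + c31 * m33 = 0 \<and> c12 * m31 + c22 * m32 + c32 * m33 = 0 \<and>
      c13 * m31 + c23 * m32 + c33 * m33 = 1"
proof -
  define d where "d = ?d"
  have "d \<noteq> 0" using assms by (simp add: d_def)
  have k: "p / d * x + q / d * y + r / d * z = (p * x + q * y + r * z) / d" for p q r x y z
    by (simp add: add_divide_distrib)
  have one: "p / d = 1" if "p = d" for p using that \<open>d \<noteq> 0\<close> by simp
  have zero: "p / d = 0" if "p = 0" for p using that by simp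
  show ?thesis
    by (rule exI[of _ "(m22 * m33 - m23 * m32) / d"], rule exI[of _ "(m23 * m31 - m21 * m33) / d"],
        rule exI[of _ "(m21 * m32 - m22 * m31) / d"], rule exI[of _ "(m13 * m32 - m12 * m33) / d"],
        rule exI[of _ "(m11 * m33 - m13 * m31) / d"], rule exI[of _ "(m12 * m31 - m11 * m32) / d"],
        rule exI[of _ "(m12 * m23 - m13 * m22) / d"], rule exI[of _ "(m13 * m21 - m11 * m23) / d"],
        rule exI[of _ "(m11 * m22 - m12 * m21) / d"], unfold k, intro conjI;
        (rule one | rule zero), simp add: d_def algebra_simps)
qed

text \<open>This is the implication from \<open>Q(g, b) = 0\<close> to \<open>b = c g\<close>. The
  slots \<open>(X, V, V, V)\<close> determine \<open>b X V\<close>, then \<open>(X, V, V, Y)\<close>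
  determines \<open>b X Y\<close>, with \<open>c = b V V / g V V\<close>. It is applied both with
  \<open>g = S\<close> and with \<open>g = h\<close>.\<close>

lemma wedge_action_zero_imp_proportional:
  assumes g: "\<And>X Y. X \<in> T \<Longrightarrow> Y \<in> T \<Longrightarrow> g X Y = (g Y X :: real)"
    and b: "\<And>X Y. X \<in> T \<Longrightarrow> Y \<in> T \<Longrightarrow> b X Y = b Y X"
    and V: "V \<in> T" "g V V \<noteq> 0"
    and zero: "\<And>X Y Z W. X \<in> T \<Longrightarrow> Y \<in> T \<Longrightarrow> Z \<in> T \<Longrightarrow> W \<in> T \<Longrightarrow> wedge_action g b X Y Z W = 0"
  shows "\<exists>c. \<forall>X\<in>T. \<forall>Y\<in>T. b X Y = c * g X Y"
proof -
  have 1: "b X V * g V V = g X V * b V V" if "X \<in> T" for X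
    using zero[of X V V V] that V by (simp add: wedge_action_def g[of V X] b[of V X] algebra_simps)
  have "b X Y = b V V / g V V * g X Y" if "X \<in> T" "Y \<in> T" for X Y
  proof -
    have "g V V * b X Y - g X V * b V Y + g V Y * b X V - g X Y * b V V = 0"
      using zero[of X V V Y] that V by (simp add: wedge_action_def)
    \<comment> \<open>By \<open>1\<close>, both sides equal \<open>g X V * g Y V * b V V\<close>, so
      the mixed terms cancel.\<close>
    moreover have "g V V * (g X V * b V Y) = g V V * (g V Y * b X V)"
      using 1[of X] 1[of Y] that V g[of V Y] b[of V Y] by algebra
    ultimately have "g V V * b X Y = b V V * g X Y"
      using V by simp
    then show ?thesis using V by (simp add: field_simps)
  qed
  then show ?thesis by blast
qed

context self_adjoint_frame
begin

text \<open>From \<open>S \<and> E = 0\<close> and rank at least three follows \<open>E = 0\<close>.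
  The inverse of the matrix with the nonzero minor turns \<open>B1\<close>, \<open>B2\<close>,
  \<open>B3\<close> into vectors \<open>C1\<close>, \<open>C2\<close>, \<open>C3\<close> dual to
  \<open>A1\<close>, \<open>A2\<close>, \<open>A3\<close> under \<open>S\<close>; evaluation at
  these isolates the values of \<open>E\<close>.\<close>

lemma kulkarni_nomizu_form_cancel:
  assumes A: "A1 \<in> T" "A2 \<in> T" "A3 \<in> T" and B: "B1 \<in> T" "B2 \<in> T" "B3 \<in> T"
    and minor: "minor3 form A1 A2 A3 B1 B2 B3 \<noteq> 0"
    and zero: "\<And>X1 X2 X3 X4. X1 \<in> T \<Longrightarrow> X2 \<in> T \<Longrightarrow> X3 \<in> T \<Longrightarrow> X4 \<in> T \<Longrightarrow>
        kulkarni_nomizu form E X1 X2 X3 X4 = 0"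
    and "X \<in> T" "Y \<in> T"
  shows "E X Y = 0"
proof -
  obtain c11 c21 c31 c12 c22 c32 c13 c23 c33 where c:
      "c11 * form A1 B1 + c21 * form A1 B2 + c31 * form A1 B3 = 1"
      "c12 * form A1 B1 + c22 * form A1 B2 + c32 * form A1 B3 = 0"
      "c13 * form A1 B1 + c23 * form A1 B2 + c33 * form A1 B3 = 0"
      "c11 * form A2 B1 + c21 * form A2 B2 + c31 * form A2 B3 = 0"
      "c12 * form A2 B1 + c22 * form A2 B2 + c32 * form A2 B3 = 1"
      "c13 * form A2 B1 + c23 * form A2 B2 + c33 * form A2 B3 = 0"
      "c11 * form A3 B1 + c21 * form A3 B2 + c31 * form A3 B3 = 0"
      "c12 * form A3 B1 + c22 * form A3 B2 + c32 * form A3 B3 = 0"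
      "c13 * form A3 B1 + c23 * form A3 B2 + c33 * form A3 B3 = 1"
    using inverse_matrix_3[OF minor[unfolded minor3_def minor2_def]] by blast
  define C1 where "C1 = c11 *\<^sub>R B1 + c21 *\<^sub>R B2 + c31 *\<^sub>R B3"
  define C2 where "C2 = c12 *\<^sub>R B1 + c22 *\<^sub>R B2 + c32 *\<^sub>R B3"
  define C3 where "C3 = c13 *\<^sub>R B1 + c23 *\<^sub>R B2 + c33 *\<^sub>R B3"
  have C: "C1 \<in> T" "C2 \<in> T" "C3 \<in> T" using B by (simp_all add: C1_def C2_def C3_def)
  have dual: "form A1 C1 = 1" "form A1 C2 = 0" "form A1 C3 = 0"
     "form A2 C1 = 0" "form A2 C2 = 1" "form A2 C3 = 0"
     "form A3 C1 = 0" "form A3 C2 = 0" "form A3 C3 = 1"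
    using c A B by (simp_all add: C1_def C2_def C3_def form_bilinear)
  note z = zero[unfolded kulkarni_nomizu_def]
  \<comment> \<open>The three pairwise sums of the diagonal values vanish, hence so does each value.
    Two dual pairs would give a single relation, which is where rank three enters.\<close>
  have "E A2 C2 + E A1 C1 = 0" "E A3 C3 + E A1 C1 = 0" "E A3 C3 + E A2 C2 = 0"
    using z[of A1 A2 C2 C1] z[of A1 A3 C3 C1] z[of A2 A3 C3 C2] A C dual by auto
  then have E0: "E A1 C1 = 0" "E A2 C2 = 0" by auto
  have E1: "E A1 C2 = 0" "E A2 C1 = 0"
    using z[of A3 A1 C2 C3] z[of A3 A2 C1 C3] A C dual by auto
  \<comment> \<open>The unknown values \<open>form X C1\<close> and \<open>form X C2\<close> only
    multiply values of \<open>E\<close> already shown to vanish.\<close>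
  have X: "E X C2 = 0" "E X C1 = 0" if "X \<in> T" for X
    using z[of A1 X C2 C1] z[of A2 X C1 C2] that A C dual E0 E1 by auto
  have Y: "E A1 Y = 0" if "Y \<in> T" for Y
    using z[of A2 A1 Y C2] that A C dual E0 E1 X by auto
  show ?thesis
    using z[of A1 X Y C1] \<open>X \<in> T\<close> \<open>Y \<in> T\<close> A C dual E0 X Y by auto
qed

section \<open>The curvature tensor of the shape operator, and the case of rank at least
  three\<close>

lemma OV_curvature_quadratic: "eq4_on T (OV_curvature h A) (quadratic_tensor h form 1 0 0)"
  by (simp add: eq4_on_def OV_curvature_def quadratic_tensor_def)

lemma OV_curvature_minor2: "OV_curvature h A X1 X2 X3 X4 = - minor2 form X1 X2 X3 X4"
  by (simp add: OV_curvature_def kulkarni_nomizu_def minor2_def algebra_simps)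

text \<open>\<open>R \<cdot> R = S \<and> (R \<cdot> S)\<close>, where \<open>R \<cdot> S\<close>
  equals \<open>Q(S, S2)\<close> for the form \<open>S2(Z, W) = h(Z, A (A W))\<close>.\<close>

lemma curvature_dot_OV_curvature:
  assumes T: "X1 \<in> T" "X2 \<in> T" "X3 \<in> T" "X4 \<in> T" "X \<in> T" "Y \<in> T"
  shows "curvature_dot T h (OV_curvature h A) (OV_curvature h A) X1 X2 X3 X4 X Y =
    kulkarni_nomizu form (wedge_action form (\<lambda>Z W. form Z (A W)) X Y) X1 X2 X3 X4"
proof -
  let ?D = "curvature_endo T h (OV_curvature h A)"
  note R = OV_curvature_quadratic
  have "curvature_dot T h (OV_curvature h A) (OV_curvature h A) X1 X2 X3 X4 X Y =
      derivation_action ?D (quadratic_tensor h form 1 0 0) X1 X2 X3 X4 X Y"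
    unfolding curvature_dot_def
    by (rule derivation_action_cong[OF R]) (use T quadratic_endo(1)[OF R] in auto)
  also have "\<dots> = kulkarni_nomizu form (derivation2 (?D X Y) form) X1 X2 X3 X4"
    unfolding derivation_action_quadratic_tensor by simp
  also have "\<dots> = kulkarni_nomizu form (wedge_action form (\<lambda>Z W. form Z (A W)) X Y) X1 X2 X3 X4"
    by (rule kulkarni_nomizu_cong[of T])
       (use T in \<open>auto simp: eq2_on_def derivation2_form_quadratic_endo[OF R] quadratic_tensor_def
          kulkarni_nomizu_def wedge_action_def algebra_simps\<close>)
  finally show ?thesis .
qed

lemma tachibana_OV_curvature:
  assumes "X1 \<in> T" "X2 \<in> T" "X3 \<in> T" "X4 \<in> T" "X \<in> T" "Y \<in> T"
  shows "tachibana h (OV_curvature h A) X1 X2 X3 X4 X Y =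
    kulkarni_nomizu form (wedge_action h form X Y) X1 X2 X3 X4"
  using tachibana_metric_quadratic[OF OV_curvature_quadratic assms] by simp

lemma form_square_commute: "X \<in> T \<Longrightarrow> Y \<in> T \<Longrightarrow> h X (A (A Y)) = h Y (A (A X))"
  using self_adjoint[of X "A Y"] self_adjoint[of Y "A X"] metric_commute[of "A X" "A Y"] by (metis operator_in)

text \<open>The Ricci tensor of \<open>R\<close> with one index raised, as
  \<open>Ricci_trace_OV_curvature\<close> confirms.\<close>

definition Ricci_operator :: "'v \<Rightarrow> 'v" where
  "Ricci_operator X = trace *\<^sub>R A X - A (A X)"

abbreviation Ricci_form :: "'v tensor2" where
  "Ricci_form \<equiv> \<lambda>X Y. h X (Ricci_operator Y)"

lemma Ricci_form:
  "X \<in> T \<Longrightarrow> Y \<in> T \<Longrightarrow> Ricci_form X Y = trace * form X Y - form X (A Y)"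
  by (simp add: Ricci_operator_def metric_bilinear)

lemma Ricci_trace_OV_curvature:
  assumes "X \<in> T" "Y \<in> T"
  shows "Ricci_trace (OV_curvature h A) X Y = Ricci_form X Y"
  using Ricci_trace_cong[OF OV_curvature_quadratic assms] assms
  by (simp add: Ricci_trace_quadratic Ricci_form)

text \<open>Allows the calculus of quadratic tensors to be reused with the Ricci tensor in the role
  of \<open>a\<close>.\<close>

lemma Ricci_frame: "self_adjoint_frame T h e Ricci_operator"
proof
  show "Ricci_operator X \<in> T" if "X \<in> T" for X
    using that by (simp add: Ricci_operator_def)
  show "h X (Ricci_operator Y) = h Y (Ricci_operator X)" if "X \<in> T" "Y \<in> T" for X Y
    using that by (simp add: Ricci_form self_adjoint[of X Y] form_square_commute[of X Y])
qed

text \<open>Cancelling \<open>S\<close> leaves \<open>Q(S, S2 + L h) = 0\<close>, with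
  \<open>S2\<close> the form of the squared operator. So \<open>S2 + L h = c S\<close> and
  \<open>Ric - L h = (trace - c) S\<close>. Here \<open>trace \<noteq> c\<close>, since otherwise
  \<open>Ric = L h\<close>; thus \<open>\<phi>\<close> is the inverse square of
  \<open>trace - c\<close>.\<close>

lemma curvature_full_rank:
  assumes A: "A1 \<in> T" "A2 \<in> T" "A3 \<in> T" and B: "B1 \<in> T" "B2 \<in> T" "B3 \<in> T"
    and minor: "minor3 form A1 A2 A3 B1 B2 B3 \<noteq> 0"
    and pseudo: "eq6_on T (curvature_dot T h (OV_curvature h A) (OV_curvature h A))
      (\<lambda>X1 X2 X3 X4 X Y. L * tachibana h (OV_curvature h A) X1 X2 X3 X4 X Y)"
    and not_Einstein: "\<nexists>c. \<forall>X\<in>T. \<forall>Y\<in>T. Ricci_form X Y = c * h X Y"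
  shows "\<exists>\<phi>. eq4_on T (OV_curvature h A) (\<lambda>X1 X2 X3 X4. \<phi> / 2 *
    kulkarni_nomizu (\<lambda>X Y. Ricci_form X Y - L * h X Y) (\<lambda>X Y. Ricci_form X Y - L * h X Y) X1 X2 X3 X4)"
proof -
  let ?b = "\<lambda>X Y. form X (A Y) + L * h X Y"
  have zero: "wedge_action form ?b X Y Z W = 0"
    if T: "X \<in> T" "Y \<in> T" "Z \<in> T" "W \<in> T" for X Y Z W
  proof -
    let ?E = "\<lambda>Z W. wedge_action form (\<lambda>Z W. form Z (A W)) X Y Z W - L * wedge_action h form X Y Z W"
    have "?E Z W = 0"
    proof (rule kulkarni_nomizu_form_cancel[OF A B minor _ T(3,4), where E = ?E])
      fix X1 X2 X3 X4 assume X: "X1 \<in> T" "X2 \<in> T" "X3 \<in> T" "X4 \<in> T"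
      have "kulkarni_nomizu form (wedge_action form (\<lambda>Z W. form Z (A W)) X Y) X1 X2 X3 X4
          = L * kulkarni_nomizu form (wedge_action h form X Y) X1 X2 X3 X4"
        using pseudo X T by (simp add: eq6_on_def curvature_dot_OV_curvature tachibana_OV_curvature)
      then show "kulkarni_nomizu form ?E X1 X2 X3 X4 = 0"
        by (simp add: kulkarni_nomizu_def algebra_simps)
    qed
    \<comment> \<open>\<open>Q(h, S) = - Q(S, h)\<close>, so the difference \<open>?E\<close> is the
      single action on \<open>?b\<close>.\<close>
    then show ?thesis
      by (simp add: wedge_action_def algebra_simps)
  qed
  \<comment> \<open>By polarization, a symmetric form without such a vector would vanish, against
    the nonzero minor.\<close>
  have "\<exists>V\<in>T. form V V \<noteq> 0"
  proof (rule ccontr)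
    assume "\<not> ?thesis"
    then have diag: "form V V = 0" if "V \<in> T" for V using that by blast
    have "form X Y = 0" if "X \<in> T" "Y \<in> T" for X Y
      using diag[of "X + Y"] diag[of X] diag[of Y] that self_adjoint[of X Y]
      by (simp add: metric_bilinear form_bilinear)
    then show False using minor A B by (simp add: minor3_def minor2_def)
  qed
  then obtain V where V: "V \<in> T" "form V V \<noteq> 0" by blast
  have "?b X Y = ?b Y X" if "X \<in> T" "Y \<in> T" for X Y
    using form_square_commute[OF that] metric_commute[OF that] by simp
  then obtain c where c: "\<forall>X\<in>T. \<forall>Y\<in>T. ?b X Y = c * form X Y"
    using wedge_action_zero_imp_proportional[of T form ?b V, OF self_adjoint _ V zero] by blast
  have Ric: "Ricci_form X Y - L * h X Y = (trace - c) * form X Y" if "X \<in> T" "Y \<in> T" for X Y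
    using c that by (auto simp: Ricci_form algebra_simps)
  have "trace \<noteq> c"
  proof
    assume "trace = c"
    then have "\<forall>X\<in>T. \<forall>Y\<in>T. Ricci_form X Y = L * h X Y" using Ric by simp
    then show False using not_Einstein by blast
  qed
  moreover have "kulkarni_nomizu (\<lambda>X Y. Ricci_form X Y - L * h X Y) (\<lambda>X Y. Ricci_form X Y - L * h X Y)
      X1 X2 X3 X4 = (trace - c)\<^sup>2 * kulkarni_nomizu form form X1 X2 X3 X4"
    if "X1 \<in> T" "X2 \<in> T" "X3 \<in> T" "X4 \<in> T" for X1 X2 X3 X4
    using that by (simp add: kulkarni_nomizu_def Ric)
      (simp add: algebra_simps power2_eq_square)
  ultimately have "eq4_on T (OV_curvature h A) (\<lambda>X1 X2 X3 X4. (1 / (trace - c)\<^sup>2) / 2 *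
    kulkarni_nomizu (\<lambda>X Y. Ricci_form X Y - L * h X Y) (\<lambda>X Y. Ricci_form X Y - L * h X Y) X1 X2 X3 X4)"
    by (simp add: eq4_on_def OV_curvature_def)
  then show ?thesis by blast
qed

section \<open>Shape forms of rank at most two\<close>

definition rank_le_2 :: bool where
  "rank_le_2 \<longleftrightarrow> (\<forall>X1\<in>T. \<forall>X2\<in>T. \<forall>X3\<in>T. \<forall>Y1\<in>T. \<forall>Y2\<in>T. \<forall>Y3\<in>T.
     minor3 form X1 X2 X3 Y1 Y2 Y3 = 0)"

text \<open>\<open>S \<and> Q(S, S2)\<close>, with \<open>S2\<close> as above, is a signed sum of
  four 3-minors of \<open>S\<close> whose first row belongs to \<open>A X\<close> or
  \<open>A Y\<close>.\<close>

lemma curvature_dot_low_rank: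
  assumes minors: rank_le_2
    and T: "X1 \<in> T" "X2 \<in> T" "X3 \<in> T" "X4 \<in> T" "X \<in> T" "Y \<in> T"
  shows "curvature_dot T h (OV_curvature h A) (OV_curvature h A) X1 X2 X3 X4 X Y = 0"
proof -
  have "kulkarni_nomizu form (wedge_action form (\<lambda>Z W. form Z (A W)) X Y) X1 X2 X3 X4 =
      minor3 form (A Y) X1 X2 X X3 X4 - minor3 form (A X) X1 X2 Y X3 X4
      + minor3 form (A Y) X3 X4 X X1 X2 - minor3 form (A X) X3 X4 Y X1 X2"
    using T
    by (simp add: minor3_def minor2_def kulkarni_nomizu_def wedge_action_def form_commute
        self_adjoint[of X1 X] form_square_commute[of X1 X]
        self_adjoint[of X2 X] form_square_commute[of X2 X]
        self_adjoint[of X3 X] form_square_commute[of X3 X]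
        self_adjoint[of X4 X] form_square_commute[of X4 X]
        self_adjoint[of X1 Y] form_square_commute[of X1 Y]
        self_adjoint[of X2 Y] form_square_commute[of X2 Y]
        self_adjoint[of X3 Y] form_square_commute[of X3 Y]
        self_adjoint[of X4 Y] form_square_commute[of X4 Y]
        self_adjoint[of X3 X1] form_square_commute[of X3 X1]
        self_adjoint[of X4 X1] form_square_commute[of X4 X1]
        self_adjoint[of X3 X2] form_square_commute[of X3 X2]
        self_adjoint[of X4 X2] form_square_commute[of X4 X2]
        self_adjoint[of Y X] form_square_commute[of Y X]
        algebra_simps)
  then show ?thesis using minors by (simp add: curvature_dot_OV_curvature rank_le_2_def T)
qed

text \<open>Cramer's rule: the vanishing 3-minor with rows \<open>X\<close>, \<open>B1\<close>,
  \<open>B2\<close> and columns \<open>Y\<close>, \<open>C1\<close>, \<open>C2\<close> is expanded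
  along the column of \<open>Y\<close>.\<close>

lemma minor2_row:
  assumes minors: rank_le_2
    and "X \<in> T" "Y \<in> T" "B1 \<in> T" "B2 \<in> T" "C1 \<in> T" "C2 \<in> T"
  shows "minor2 form B1 B2 C1 C2 * form X Y =
    minor2 form X B2 C1 C2 * form B1 Y + minor2 form B1 X C1 C2 * form B2 Y"
  using minors[unfolded rank_le_2_def, rule_format, of X B1 B2 Y C1 C2] assms(2-)
  by (simp add: minor3_def minor2_def algebra_simps)

text \<open>The 2-minors of a rank two form make up a form of rank one on pairs. By
  \<open>minor2_row\<close> the rows of \<open>X1\<close>, \<open>X2\<close> are combinations of
  those of \<open>B1\<close>, \<open>B2\<close>, so passing to them multiplies minors by a factor
  that does not depend on the columns; the columns \<open>C1\<close>, \<open>C2\<close> evaluate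
  this factor.\<close>

lemma minor2_compound:
  assumes minors: rank_le_2
    and X: "X1 \<in> T" "X2 \<in> T" "X3 \<in> T" "X4 \<in> T" and B: "B1 \<in> T" "B2 \<in> T" "C1 \<in> T" "C2 \<in> T"
    and nz: "minor2 form B1 B2 C1 C2 \<noteq> 0"
  shows "minor2 form B1 B2 C1 C2 * minor2 form X1 X2 X3 X4 =
    minor2 form X1 X2 C1 C2 * minor2 form B1 B2 X3 X4"
proof -
  define r where "r = minor2 form B1 B2 C1 C2"
  define d where "d = minor2 form X1 B2 C1 C2 * minor2 form B1 X2 C1 C2
    - minor2 form B1 X1 C1 C2 * minor2 form X2 B2 C1 C2"
  have row: "r * form X Y = minor2 form X B2 C1 C2 * form B1 Y + minor2 form B1 X C1 C2 * form B2 Y"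
    if "X \<in> T" "Y \<in> T" for X Y
    unfolding r_def using minor2_row[OF minors that B] .
  have expand: "r * r * minor2 form X1 X2 Y Z = d * minor2 form B1 B2 Y Z"
    if "Y \<in> T" "Z \<in> T" for Y Z
  proof -
    have "r * r * minor2 form X1 X2 Y Z =
        (r * form X1 Y) * (r * form X2 Z) - (r * form X1 Z) * (r * form X2 Y)"
      by (simp add: minor2_def[of form X1] algebra_simps)
    also have "\<dots> = d * (form B1 Y * form B2 Z - form B1 Z * form B2 Y)"
      unfolding row[OF X(1) that(1)] row[OF X(1) that(2)] row[OF X(2) that(1)] row[OF X(2) that(2)]
      by (simp add: d_def algebra_simps)
    finally show ?thesis by (simp add: minor2_def)
  qed
  have "r * r * (r * minor2 form X1 X2 X3 X4) = r * (r * r * minor2 form X1 X2 X3 X4)"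
    by simp
  also have "\<dots> = (d * r) * minor2 form B1 B2 X3 X4"
    unfolding expand[OF X(3,4)] by simp
  also have "d * r = r * r * minor2 form X1 X2 C1 C2"
    unfolding expand[OF B(3,4)] by (simp add: r_def)
  finally have "r * r * (r * minor2 form X1 X2 X3 X4) =
      r * r * (minor2 form X1 X2 C1 C2 * minor2 form B1 B2 X3 X4)"
    by (simp add: mult.assoc)
  then show ?thesis using nz by (simp add: r_def)
qed

text \<open>A symmetric form of rank two restricts to a form on the two-dimensional quotient by its kernel;
  there the operator \<open>trace - A\<close> multiplies 2-minors by its determinant.\<close>

lemma minor2_Ricci_form:
  assumes minors: rank_le_2
    and X: "X1 \<in> T" "X2 \<in> T" "X3 \<in> T" "X4 \<in> T" and B: "B1 \<in> T" "B2 \<in> T" "C1 \<in> T" "C2 \<in> T"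
    and nz: "minor2 form B1 B2 C1 C2 \<noteq> 0"
  shows "minor2 form B1 B2 C1 C2 * minor2 Ricci_form X1 X2 X3 X4 =
    minor2 form X1 X2 X3 X4 * minor2 Ricci_form B1 B2 C1 C2"
proof -
  define N where "N X = trace *\<^sub>R X - A X" for X
  define r where "r = minor2 form B1 B2 C1 C2"
  have N: "N X \<in> T" if "X \<in> T" for X using that by (simp add: N_def)
  have form_N: "form (N X) Y = Ricci_form X Y" "form X (N Y) = Ricci_form X Y"
    if "X \<in> T" "Y \<in> T" for X Y
    using that by (simp_all add: N_def Ricci_form metric_bilinear form_bilinear form_commute)
  \<comment> \<open>As \<open>Ric = S(N \<cdot>, \<cdot>) = S(\<cdot>, N \<cdot>)\<close>, the
    operator can sit on the rows or on the columns; \<open>minor2_compound\<close> is used once with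
    each placement.\<close>
  have left: "minor2 Ricci_form X Y Z W = minor2 form (N X) (N Y) Z W"
    and right: "minor2 Ricci_form X Y Z W = minor2 form X Y (N Z) (N W)"
    if "X \<in> T" "Y \<in> T" "Z \<in> T" "W \<in> T" for X Y Z W
    using that by (simp_all add: minor2_def form_N)
  note compound = minor2_compound[OF minors _ _ _ _ B nz, folded r_def]
  have "r * (r * minor2 Ricci_form X1 X2 X3 X4) = (r * minor2 Ricci_form X1 X2 C1 C2) * minor2 form B1 B2 X3 X4"
    using compound[of "N X1" "N X2" X3 X4] X B N by (simp add: left)
  also have "r * minor2 Ricci_form X1 X2 C1 C2 = minor2 form X1 X2 C1 C2 * minor2 Ricci_form B1 B2 C1 C2"
    using compound[of X1 X2 "N C1" "N C2"] X B N by (simp add: right)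
  finally have "r * (r * minor2 Ricci_form X1 X2 X3 X4) =
      (r * minor2 form X1 X2 X3 X4) * minor2 Ricci_form B1 B2 C1 C2"
    using compound[OF X] by simp
  then show ?thesis using nz by (simp add: r_def)
qed

text \<open>Contracting the first and fourth slots of \<open>Q(h, R)\<close> gives
  \<open>Q(h, Ric)\<close>; its vanishing makes \<open>Ric\<close> proportional to
  \<open>h\<close>.\<close>

lemma Einstein_if_tachibana_zero:
  assumes zero: "\<And>X1 X2 X3 X4 X Y. X1 \<in> T \<Longrightarrow> X2 \<in> T \<Longrightarrow> X3 \<in> T \<Longrightarrow> X4 \<in> T \<Longrightarrow> X \<in> T \<Longrightarrow> Y \<in> T \<Longrightarrow>
      tachibana h (OV_curvature h A) X1 X2 X3 X4 X Y = 0"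
  shows "\<exists>c. \<forall>X\<in>T. \<forall>Y\<in>T. Ricci_form X Y = c * h X Y"
proof -
  have "wedge_action h Ricci_form X Y Z W = 0"
    if T: "X \<in> T" "Y \<in> T" "Z \<in> T" "W \<in> T" for X Y Z W
  proof -
    define q where "q = wedge_action h form X Y"
    have c: "(\<Sum>j\<in>UNIV. h (e j) (e j) * (h U (e j) * h (e j) V)) = h U V" if "U \<in> T" "V \<in> T" for U V
      using metric_contraction that .
    have "0 = (\<Sum>j\<in>UNIV. h (e j) (e j) * kulkarni_nomizu form q (e j) Z W (e j))"
      using zero T by (simp add: tachibana_OV_curvature q_def)
    \<comment> \<open>The summand is sorted so that each term is a constant times a summand of
      \<open>trace\<close> or of \<open>metric_contraction\<close>.\<close>
    also have "\<dots> = (\<Sum>j\<in>UNIV. q Z W * (h (e j) (e j) * form (e j) (e j))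
        - 2 * form Z W * (h (e j) (e j) * (h Y (e j) * h (e j) (A X)))
        + 2 * form Z W * (h (e j) (e j) * (h X (e j) * h (e j) (A Y)))
        + h Y Z * (h (e j) (e j) * (h (A X) (e j) * h (e j) (A W)))
        - h X Z * (h (e j) (e j) * (h (A Y) (e j) * h (e j) (A W)))
        + form X Z * (h (e j) (e j) * (h Y (e j) * h (e j) (A W)))
        - form Y Z * (h (e j) (e j) * (h X (e j) * h (e j) (A W)))
        + form X W * (h (e j) (e j) * (h (A Z) (e j) * h (e j) Y))
        - form Y W * (h (e j) (e j) * (h (A Z) (e j) * h (e j) X))
        + h Y W * (h (e j) (e j) * (h (A Z) (e j) * h (e j) (A X)))
        - h X W * (h (e j) (e j) * (h (A Z) (e j) * h (e j) (A Y))))"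
    proof (rule sum.cong[OF refl])
      fix j
      have 1: "form X (e j) = h (e j) (A X)" "form Y (e j) = h (e j) (A Y)" "form Z (e j) = h (e j) (A Z)"
        "h X (e j) = h (e j) X" "h Y (e j) = h (e j) Y"
        "h (A X) (e j) = h (e j) (A X)" "h (A Y) (e j) = h (e j) (A Y)" "h (A Z) (e j) = h (e j) (A Z)"
        using T by (auto intro: self_adjoint metric_commute)
      show "h (e j) (e j) * kulkarni_nomizu form q (e j) Z W (e j) =
        q Z W * (h (e j) (e j) * form (e j) (e j))
        - 2 * form Z W * (h (e j) (e j) * (h Y (e j) * h (e j) (A X)))
        + 2 * form Z W * (h (e j) (e j) * (h X (e j) * h (e j) (A Y)))
        + h Y Z * (h (e j) (e j) * (h (A X) (e j) * h (e j) (A W)))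
        - h X Z * (h (e j) (e j) * (h (A Y) (e j) * h (e j) (A W)))
        + form X Z * (h (e j) (e j) * (h Y (e j) * h (e j) (A W)))
        - form Y Z * (h (e j) (e j) * (h X (e j) * h (e j) (A W)))
        + form X W * (h (e j) (e j) * (h (A Z) (e j) * h (e j) Y))
        - form Y W * (h (e j) (e j) * (h (A Z) (e j) * h (e j) X))
        + h Y W * (h (e j) (e j) * (h (A Z) (e j) * h (e j) (A X)))
        - h X W * (h (e j) (e j) * (h (A Z) (e j) * h (e j) (A Y)))"
        unfolding kulkarni_nomizu_def q_def wedge_action_def 1 by (simp add: algebra_simps)
    qed
    also have "\<dots> = q Z W * trace - 2 * form Z W * form Y X + 2 * form Z W * form X Y
        + h Y Z * h (A X) (A W) - h X Z * h (A Y) (A W) + form X Z * form Y W - form Y Z * form X W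
        + form X W * h (A Z) Y - form Y W * h (A Z) X + h Y W * h (A Z) (A X) - h X W * h (A Z) (A Y)"
      unfolding sum.distrib sum_subtractf sum_distrib_left[symmetric]
      by (simp add: c T trace_def)
    also have "\<dots> = wedge_action h Ricci_form X Y Z W"
      using T by (simp add: q_def wedge_action_def Ricci_form form_commute self_adjoint[of Z X]
          self_adjoint[of Z Y] self_adjoint[of Y X] form_square_commute[of Z X]
          form_square_commute[of Z Y] algebra_simps)
    finally show ?thesis by simp
  qed
  moreover have "h (e j) (e j) \<noteq> 0" for j
    using frame_sign[of j] by auto
  moreover have "Ricci_form X Y = Ricci_form Y X" if "X \<in> T" "Y \<in> T" for X Y
    using self_adjoint_frame.self_adjoint[OF Ricci_frame that] .
  \<comment> \<open>Any frame vector has nonzero \<open>h\<close>-square, so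
    \<open>e undefined\<close> can serve as \<open>V\<close>.\<close>
  ultimately show ?thesis
    using wedge_action_zero_imp_proportional[of T h Ricci_form "e undefined", OF metric_commute]
    by simp
qed

text \<open>Joins the two rank cases. The vectors \<open>V1\<close> to \<open>V4\<close> are
  supplied later by the rank hypothesis and serve when \<open>S\<close> has rank at most
  two.\<close>

lemma curvature_from_pseudosymmetry:
  assumes pseudo: "eq6_on T (curvature_dot T h (OV_curvature h A) (OV_curvature h A))
      (\<lambda>X1 X2 X3 X4 X Y. L * tachibana h (OV_curvature h A) X1 X2 X3 X4 X Y)"
    and not_Einstein: "\<nexists>c. \<forall>X\<in>T. \<forall>Y\<in>T. Ricci_form X Y = c * h X Y"
    and V: "V1 \<in> T" "V2 \<in> T" "V3 \<in> T" "V4 \<in> T" "minor2 Ricci_form V1 V2 V3 V4 \<noteq> 0"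
  shows "\<exists>\<phi>. eq4_on T (OV_curvature h A) (\<lambda>X1 X2 X3 X4. \<phi> / 2 *
    kulkarni_nomizu (\<lambda>X Y. Ricci_form X Y - L * h X Y) (\<lambda>X Y. Ricci_form X Y - L * h X Y) X1 X2 X3 X4)"
proof (cases rank_le_2)
  case False
  then show ?thesis unfolding rank_le_2_def using curvature_full_rank[OF _ _ _ _ _ _ _ pseudo not_Einstein] by blast
next
  case minors: True
  have "L = 0"
  proof (rule ccontr)
    assume "L \<noteq> 0"
    then have "tachibana h (OV_curvature h A) X1 X2 X3 X4 X Y = 0"
      if "X1 \<in> T" "X2 \<in> T" "X3 \<in> T" "X4 \<in> T" "X \<in> T" "Y \<in> T" for X1 X2 X3 X4 X Y
      using pseudo curvature_dot_low_rank[OF minors] that by (simp add: eq6_on_def)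
    then show False using Einstein_if_tachibana_zero not_Einstein by blast
  qed
  \<comment> \<open>A 2-minor of the Ricci form is a 2-minor of \<open>S\<close> with both row
    vectors moved by \<open>trace - A\<close>.\<close>
  have "\<exists>B1\<in>T. \<exists>B2\<in>T. \<exists>C1\<in>T. \<exists>C2\<in>T. minor2 form B1 B2 C1 C2 \<noteq> 0"
  proof (rule ccontr)
    assume "\<not> ?thesis"
    then have "minor2 form (trace *\<^sub>R V1 - A V1) (trace *\<^sub>R V2 - A V2) V3 V4 = 0"
      using V by simp
    then show False
      using V by (simp add: minor2_def Ricci_form metric_bilinear form_commute)
  qed
  then obtain B1 B2 C1 C2 where B: "B1 \<in> T" "B2 \<in> T" "C1 \<in> T" "C2 \<in> T"
    and nz: "minor2 form B1 B2 C1 C2 \<noteq> 0" by blast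
  note Ric = minor2_Ricci_form[OF minors _ _ _ _ B nz]
  \<comment> \<open>The common ratio between the 2-minors of \<open>S\<close> and those of the Ricci
    form, read off at the reference vectors.\<close>
  define \<phi> where "\<phi> = minor2 form B1 B2 C1 C2 / minor2 Ricci_form B1 B2 C1 C2"
  have "minor2 Ricci_form B1 B2 C1 C2 \<noteq> 0"
    using Ric[OF V(1-4)] V(5) nz by auto
  then have minor: "minor2 form X1 X2 X3 X4 = \<phi> * minor2 Ricci_form X1 X2 X3 X4"
    if "X1 \<in> T" "X2 \<in> T" "X3 \<in> T" "X4 \<in> T" for X1 X2 X3 X4
    using Ric[OF that] by (simp add: \<phi>_def field_simps)
  have "kulkarni_nomizu Ricci_form Ricci_form X1 X2 X3 X4 = - 2 * minor2 Ricci_form X1 X2 X3 X4"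
    for X1 X2 X3 X4
    by (simp add: kulkarni_nomizu_def minor2_def)
  then have "eq4_on T (OV_curvature h A) (\<lambda>X1 X2 X3 X4. \<phi> / 2 *
    kulkarni_nomizu (\<lambda>X Y. Ricci_form X Y - L * h X Y) (\<lambda>X Y. Ricci_form X Y - L * h X Y) X1 X2 X3 X4)"
    using minor by (simp add: eq4_on_def OV_curvature_minor2 \<open>L = 0\<close>)
  then show ?thesis by blast
qed

end

section \<open>Curvature tensors that are quadratic in their own Ricci tensor\<close>

locale quadratic_curvature = self_adjoint_frame T h e A
  for T :: "'v::real_vector set" and h :: "'v tensor2" and e :: "'n::finite \<Rightarrow> 'v" and A :: "'v \<Rightarrow> 'v" +
  fixes R W :: "'v tensor4" and \<phi> \<mu> \<eta> n :: real
  assumes n: "n = real CARD('n)" "n \<ge> 4"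
    and curvature: "eq4_on T R (quadratic_tensor h form \<phi> \<mu> \<eta>)"
    and Ricci: "\<And>X Y. X \<in> T \<Longrightarrow> Y \<in> T \<Longrightarrow> Ricci_trace R X Y = form X Y"
    and Weyl: "eq4_on T W (\<lambda>X1 X2 X3 X4. R X1 X2 X3 X4
      - 1 / (n - 2) * kulkarni_nomizu h form X1 X2 X3 X4
      + trace / (2 * (n - 2) * (n - 1)) * kulkarni_nomizu h h X1 X2 X3 X4)"
    and not_Einstein: "\<nexists>c. \<forall>X\<in>T. \<forall>Y\<in>T. form X Y = c * h X Y"
    and Weyl_nonzero: "\<not> eq4_on T W (\<lambda>X1 X2 X3 X4. 0)"
begin

lemma Weyl_quadratic:
  "eq4_on T W (quadratic_tensor h form \<phi> (\<mu> - 1 / (n - 2)) (\<eta> + trace / ((n - 2) * (n - 1))))"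
proof -
  define c d where "c = trace / ((n - 2) * (n - 1))" and "d = 1 / (n - 2)"
  have "trace / (2 * (n - 2) * (n - 1)) = c / 2"
    by (simp add: c_def)
  then show ?thesis
    using Weyl curvature unfolding c_def[symmetric] d_def[symmetric]
    by (simp only:) (simp add: eq4_on_def quadratic_tensor_def algebra_simps)
qed

text \<open>In this locale \<open>A\<close> is the Ricci operator and \<open>trace\<close> the
  scalar curvature, so contracting the formula for \<open>R\<close> yields an equation for the Ricci
  tensor itself.\<close>

lemma Ricci_quadratic:
  assumes "X \<in> T" "Y \<in> T"
  shows "form X Y = \<phi> * (trace * form X Y - form X (A Y))
    + \<mu> * (n * form X Y + trace * h X Y - 2 * form X Y) + \<eta> * (n - 1) * h X Y"
  using Ricci[OF assms] Ricci_trace_cong[OF curvature assms] Ricci_trace_quadratic[OF assms] n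
  by simp

text \<open>Without the \<open>a \<and> a\<close> term the contraction is linear in
  \<open>Ric\<close>. As \<open>Ric\<close> is not a multiple of \<open>h\<close>, it forces
  \<open>\<mu> = 1 / (n - 2)\<close> and then the value of \<open>\<eta>\<close> for which the Weyl
  part vanishes.\<close>

lemma leading_coefficient_nonzero: "\<phi> \<noteq> 0"
proof
  assume "\<phi> = 0"
  then have eq: "(1 - (n - 2) * \<mu>) * form X Y = (\<mu> * trace + \<eta> * (n - 1)) * h X Y"
    if "X \<in> T" "Y \<in> T" for X Y
    using Ricci_quadratic[OF that] by (simp add: algebra_simps)
  have \<mu>: "(n - 2) * \<mu> = 1"
  proof (rule ccontr)
    assume "(n - 2) * \<mu> \<noteq> 1"
    then have "form X Y = (\<mu> * trace + \<eta> * (n - 1)) / (1 - (n - 2) * \<mu>) * h X Y"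
      if "X \<in> T" "Y \<in> T" for X Y
      using eq[OF that] by (simp add: field_simps)
    then show False using not_Einstein by blast
  qed
  have "h (e undefined) (e undefined) \<noteq> 0"
    using frame_sign[of undefined] by auto
  then have "\<mu> * trace + \<eta> * (n - 1) = 0"
    using eq[of "e undefined" "e undefined"] \<mu> by simp
  then have "\<eta> = - (\<mu> * trace) / (n - 1)"
    using n(2) by (simp add: field_simps)
  moreover have "\<mu> = 1 / (n - 2)"
    using \<mu> n(2) by (simp add: field_simps)
  ultimately have "eq4_on T W (\<lambda>X1 X2 X3 X4. 0)"
    using Weyl_quadratic \<open>\<phi> = 0\<close> by (simp add: eq4_on_def quadratic_tensor_def)
  then show False using Weyl_nonzero by simp
qed

text \<open>The contracted equation divided by \<open>\<phi>\<close>; its coefficients are the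
  \<open>\<alpha>\<close> and \<open>\<beta>\<close> of
  \<open>curvature_dot_quadratic\<close>.\<close>

lemma Ricci_square:
  assumes "X \<in> T" "Y \<in> T"
  shows "h X (A (A Y)) = (trace + ((n - 2) * \<mu> - 1) / \<phi>) * h X (A Y)
    + ((\<mu> * trace + \<eta> * (n - 1)) / \<phi>) * h X Y"
proof -
  have "\<phi> * inverse \<phi> = 1" using leading_coefficient_nonzero by simp
  then show ?thesis using Ricci_quadratic[OF assms] unfolding divide_inverse by algebra
qed

lemma curvature_dot_eq:
  assumes "eq4_on T B (quadratic_tensor h form \<phi>' \<mu>' \<eta>')"
    and "eq4_on T t (quadratic_tensor h form \<phi>'' \<mu>'' \<eta>'')"
    and "X1 \<in> T" "X2 \<in> T" "X3 \<in> T" "X4 \<in> T" "X \<in> T" "Y \<in> T"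
  shows "curvature_dot T h B t X1 X2 X3 X4 X Y =
    (\<mu>' * (trace + ((n - 2) * \<mu> - 1) / \<phi>) + \<eta>' - \<phi>' * ((\<mu> * trace + \<eta> * (n - 1)) / \<phi>)) *
    (\<phi>'' * kulkarni_nomizu form (wedge_action h form X Y) X1 X2 X3 X4
     + \<mu>'' * kulkarni_nomizu h (wedge_action h form X Y) X1 X2 X3 X4)"
  by (rule curvature_dot_quadratic[OF assms(1,2) _ assms(3-)]) (rule Ricci_square)

text \<open>Both sides involve the same combination with coefficients \<open>\<phi>\<close> and
  \<open>\<mu>\<close>, so only scalars are compared; the scalar curvature cancels between
  them.\<close>

lemma pseudosymmetry:
  assumes T: "X1 \<in> T" "X2 \<in> T" "X3 \<in> T" "X4 \<in> T" "X \<in> T" "Y \<in> T"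
  shows "curvature_dot T h R R X1 X2 X3 X4 X Y =
    ((n - 2) * (\<mu>\<^sup>2 - \<phi> * \<eta>) - \<mu>) * inverse \<phi> * tachibana h R X1 X2 X3 X4 X Y"
proof -
  have c: "\<mu> * (trace + ((n - 2) * \<mu> - 1) / \<phi>) + \<eta> - \<phi> * ((\<mu> * trace + \<eta> * (n - 1)) / \<phi>) =
      ((n - 2) * (\<mu>\<^sup>2 - \<phi> * \<eta>) - \<mu>) * inverse \<phi>"
    using leading_coefficient_nonzero by (simp add: field_simps power2_eq_square)
  show ?thesis
    unfolding tachibana_metric_quadratic[OF curvature T]
      curvature_dot_eq[OF curvature curvature T] c ..
qed

text \<open>The values of \<open>\<mu>\<close> and \<open>\<eta>\<close> are those of
  \<open>(\<phi> / 2) (Ric - L h) \<and> (Ric - L h)\<close>. All four terms are combinations of the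
  same \<open>P\<close> and \<open>Q\<close>.\<close>

lemma Weyl_dot_identity:
  assumes \<mu>: "\<mu> = - \<phi> * L" and \<eta>: "\<eta> = \<phi> * L\<^sup>2" and a: "eq2_on T a form"
    and T: "X1 \<in> T" "X2 \<in> T" "X3 \<in> T" "X4 \<in> T" "X \<in> T" "Y \<in> T"
  shows "curvature_dot T h W R X1 X2 X3 X4 X Y - curvature_dot T h R W X1 X2 X3 X4 X Y =
    tachibana a W X1 X2 X3 X4 X Y - trace / (n - 1) * tachibana h W X1 X2 X3 X4 X Y"
proof -
  define P where "P = kulkarni_nomizu form (wedge_action h form X Y) X1 X2 X3 X4"
  define Q where "Q = kulkarni_nomizu h (wedge_action h form X Y) X1 X2 X3 X4"
  have nz: "\<phi> \<noteq> 0" "n - 2 \<noteq> 0" "n - 1 \<noteq> 0"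
    using leading_coefficient_nonzero n by auto
  \<comment> \<open>Naming the inverses together with their defining equations turns the comparison
    of coefficients into a polynomial identity.\<close>
  define m k where "m = inverse (n - 2)" and "k = inverse (n - 1)"
  have mk: "m * (n - 2) = 1" "k * (n - 1) = 1" using nz by (auto simp: m_def k_def)
  define f where "f = inverse \<phi>"
  have f: "f * \<phi> = 1" using nz by (simp add: f_def)
  show ?thesis
    unfolding tachibana_metric_quadratic[OF Weyl_quadratic T]
      tachibana_form_quadratic[OF Weyl_quadratic a T]
      curvature_dot_eq[OF Weyl_quadratic curvature T]
      curvature_dot_eq[OF curvature Weyl_quadratic T]
      P_def[symmetric] Q_def[symmetric] \<mu> \<eta> divide_inverse inverse_mult_distrib
      m_def[symmetric] k_def[symmetric] f_def[symmetric]
    using f mk by algebra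
qed

end

section \<open>Symmetry of second derivatives\<close>

lemma smooth_on_differentiable:
  assumes "smooth_on U f" "x \<in> U"
  shows "f differentiable at x" "(\<lambda>x. frechet_derivative f (at x) w) differentiable at x"
proof -
  have "Ck_on 2 f U" using assms unfolding smooth_on_def by blast
  then show "f differentiable at x" "(\<lambda>x. frechet_derivative f (at x) w) differentiable at x"
    using assms(2) by (auto simp: numeral_2_eq_2)
qed

lemma smooth_on_continuous_second_derivative:
  assumes "smooth_on U f"
  shows "continuous_on U (\<lambda>x. second_derivative f x v w)"
proof -
  have "Ck_on 2 f U" using assms unfolding smooth_on_def by blast
  then show ?thesis by (auto simp: numeral_2_eq_2 second_derivative_def)
qed

lemma has_real_derivative_along_line:
  fixes f :: "'a::real_normed_vector \<Rightarrow> 'b::euclidean_space"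
  assumes "f differentiable at (c + s *\<^sub>R v)"
  shows "((\<lambda>s. f (c + s *\<^sub>R v) \<bullet> b) has_real_derivative
    frechet_derivative f (at (c + s *\<^sub>R v)) v \<bullet> b) (at s)"
proof -
  let ?D = "frechet_derivative f (at (c + s *\<^sub>R v))"
  have D: "(f has_derivative ?D) (at (c + s *\<^sub>R v))"
    using assms by (simp add: frechet_derivative_works)
  have "((\<lambda>s. c + s *\<^sub>R v) has_derivative (\<lambda>t. t *\<^sub>R v)) (at s)"
    by (auto intro!: derivative_eq_intros)
  then have "((\<lambda>s. f (c + s *\<^sub>R v)) has_derivative (\<lambda>t. ?D (t *\<^sub>R v))) (at s)"
    using D by (rule has_derivative_compose)
  then have "((\<lambda>s. f (c + s *\<^sub>R v) \<bullet> b) has_derivative (\<lambda>t. ?D (t *\<^sub>R v) \<bullet> b)) (at s)"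
    by (auto intro!: derivative_eq_intros)
  moreover have "(\<lambda>t. ?D (t *\<^sub>R v) \<bullet> b) = (*) (?D v \<bullet> b)"
    using has_derivative_linear[OF D] by (auto simp: linear_cmul)
  ultimately show ?thesis by (simp add: has_field_derivative_def)
qed

text \<open>The real mean value theorem is applied twice, first along \<open>v\<close> and then
  along \<open>w\<close>. Pairing with \<open>b\<close> is what provides a single intermediate
  point.\<close>

lemma second_difference_mean_value:
  fixes f :: "'a::euclidean_space \<Rightarrow> 'b::euclidean_space"
  assumes f: "smooth_on U f" and "0 < r"
    and U: "\<And>s t. 0 \<le> s \<Longrightarrow> s \<le> r \<Longrightarrow> 0 \<le> t \<Longrightarrow> t \<le> r \<Longrightarrow> u + s *\<^sub>R v + t *\<^sub>R w \<in> U"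
  shows "\<exists>s t. 0 \<le> s \<and> s \<le> r \<and> 0 \<le> t \<and> t \<le> r \<and>
    (f (u + r *\<^sub>R v + r *\<^sub>R w) - f (u + r *\<^sub>R v) - f (u + r *\<^sub>R w) + f u) \<bullet> b =
      r * r * (second_derivative f (u + s *\<^sub>R v + t *\<^sub>R w) w v \<bullet> b)"
proof -
  define \<phi> where "\<phi> s = f (u + r *\<^sub>R w + s *\<^sub>R v) \<bullet> b - f (u + s *\<^sub>R v) \<bullet> b" for s
  define \<phi>' where "\<phi>' s = frechet_derivative f (at (u + r *\<^sub>R w + s *\<^sub>R v)) v \<bullet> b
      - frechet_derivative f (at (u + s *\<^sub>R v)) v \<bullet> b" for s
  have "(\<phi> has_real_derivative \<phi>' s) (at s)" if "0 \<le> s" "s \<le> r" for s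
    unfolding \<phi>_def \<phi>'_def
    using U[of s r] U[of s 0] that \<open>0 < r\<close>
    by (intro DERIV_diff has_real_derivative_along_line smooth_on_differentiable[OF f])
       (auto simp: algebra_simps)
  from MVT2[OF \<open>0 < r\<close> this] obtain s where s: "0 < s" "s < r" "\<phi> r - \<phi> 0 = (r - 0) * \<phi>' s"
    by blast
  define g where "g t = frechet_derivative f (at (u + s *\<^sub>R v + t *\<^sub>R w)) v \<bullet> b" for t
  have "(g has_real_derivative second_derivative f (u + s *\<^sub>R v + t *\<^sub>R w) w v \<bullet> b) (at t)"
    if "0 \<le> t" "t \<le> r" for t
    unfolding g_def second_derivative_def
    using has_real_derivative_along_line[OF smooth_on_differentiable(2)[OF f U[of s t]]] s that
    by simp
  from MVT2[OF \<open>0 < r\<close> this] obtain t where t: "0 < t" "t < r"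
      "g r - g 0 = (r - 0) * (second_derivative f (u + s *\<^sub>R v + t *\<^sub>R w) w v \<bullet> b)"
    by blast
  have "\<phi>' s = g r - g 0"
    by (simp add: \<phi>'_def g_def algebra_simps)
  then have "\<phi> r - \<phi> 0 = r * r * (second_derivative f (u + s *\<^sub>R v + t *\<^sub>R w) w v \<bullet> b)"
    using s(3) t(3) by simp
  moreover have "\<phi> r - \<phi> 0 = (f (u + r *\<^sub>R v + r *\<^sub>R w) - f (u + r *\<^sub>R v) - f (u + r *\<^sub>R w) + f u) \<bullet> b"
    by (simp add: \<phi>_def algebra_simps)
  ultimately show ?thesis using s t by (metis less_imp_le)
qed

text \<open>The second difference over a parallelogram is symmetric in \<open>v\<close> and
  \<open>w\<close>, and it is \<open>r * r\<close> times either mixed derivative at some nearby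
  point. Continuity then excludes different values at \<open>u\<close>.\<close>

lemma second_derivative_commute:
  fixes f :: "'a::euclidean_space \<Rightarrow> 'b::euclidean_space"
  assumes f: "smooth_on U f" and "open U" "u \<in> U"
  shows "second_derivative f u v w = second_derivative f u w v"
proof (rule euclidean_eqI, rule ccontr)
  fix b :: 'b
  let ?P = "\<lambda>x. second_derivative f x v w \<bullet> b" and ?Q = "\<lambda>x. second_derivative f x w v \<bullet> b"
  assume "?P u \<noteq> ?Q u"
  then have "\<bar>?P u - ?Q u\<bar> / 2 > 0" (is "?\<epsilon> > 0") by simp
  have cont: "isCont ?P u" "isCont ?Q u"
    using smooth_on_continuous_second_derivative[OF f] \<open>open U\<close> \<open>u \<in> U\<close>
    by (auto intro!: continuous_intros simp: continuous_on_eq_continuous_at)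
  obtain d1 where d1: "d1 > 0" "\<And>x. dist x u < d1 \<Longrightarrow> \<bar>?P x - ?P u\<bar> < ?\<epsilon>"
    using cont(1) \<open>?\<epsilon> > 0\<close> unfolding continuous_at_eps_delta dist_real_def by blast
  obtain d2 where d2: "d2 > 0" "\<And>x. dist x u < d2 \<Longrightarrow> \<bar>?Q x - ?Q u\<bar> < ?\<epsilon>"
    using cont(2) \<open>?\<epsilon> > 0\<close> unfolding continuous_at_eps_delta dist_real_def by blast
  obtain d3 where d3: "d3 > 0" "\<And>x. dist x u < d3 \<Longrightarrow> x \<in> U"
    using \<open>open U\<close> \<open>u \<in> U\<close> unfolding open_dist by blast
  define d where "d = min d1 (min d2 d3)"
  \<comment> \<open>This keeps the parallelogram with sides \<open>r v\<close> and
    \<open>r w\<close> inside the ball of radius \<open>d\<close>; the summand 1 covers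
    \<open>v = w = 0\<close>.\<close>
  define r where "r = d / (norm v + norm w + 1)"
  have "d > 0" using d1 d2 d3 by (simp add: d_def)
  have pos: "norm v + norm w + 1 > 0" by (smt (verit) norm_ge_zero)
  have "r > 0" using \<open>d > 0\<close> pos by (simp add: r_def)
  have near: "dist (u + s *\<^sub>R v + t *\<^sub>R w) u < d" if "0 \<le> s" "s \<le> r" "0 \<le> t" "t \<le> r" for s t
  proof -
    have "dist (u + s *\<^sub>R v + t *\<^sub>R w) u = norm (s *\<^sub>R v + t *\<^sub>R w)"
      by (simp add: dist_norm)
    also have "\<dots> \<le> s * norm v + t * norm w"
      using norm_triangle_ineq[of "s *\<^sub>R v" "t *\<^sub>R w"] that by simp
    also have "\<dots> \<le> r * norm v + r * norm w"
      using that by (intro add_mono mult_right_mono) auto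
    also have "\<dots> < r * (norm v + norm w + 1)"
      using \<open>r > 0\<close> by (simp add: algebra_simps)
    also have "\<dots> = d" using pos by (simp add: r_def)
    finally show ?thesis .
  qed
  have near': "dist (u + t *\<^sub>R w + s *\<^sub>R v) u < d" if "0 \<le> s" "s \<le> r" "0 \<le> t" "t \<le> r" for s t
    using near[OF that] by (simp add: algebra_simps)
  obtain s t where st: "0 \<le> s" "s \<le> r" "0 \<le> t" "t \<le> r"
      "(f (u + r *\<^sub>R v + r *\<^sub>R w) - f (u + r *\<^sub>R v) - f (u + r *\<^sub>R w) + f u) \<bullet> b =
        r * r * ?Q (u + s *\<^sub>R v + t *\<^sub>R w)"
    using second_difference_mean_value[OF f \<open>r > 0\<close>, of u v w b] near d3(2) by (auto simp: d_def)
  obtain s' t' where st': "0 \<le> s'" "s' \<le> r" "0 \<le> t'" "t' \<le> r"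
      "(f (u + r *\<^sub>R w + r *\<^sub>R v) - f (u + r *\<^sub>R w) - f (u + r *\<^sub>R v) + f u) \<bullet> b =
        r * r * ?P (u + s' *\<^sub>R w + t' *\<^sub>R v)"
    using second_difference_mean_value[OF f \<open>r > 0\<close>, of u w v b] near' d3(2) by (auto simp: d_def)
  have "r * r * ?Q (u + s *\<^sub>R v + t *\<^sub>R w) = r * r * ?P (u + s' *\<^sub>R w + t' *\<^sub>R v)"
    unfolding st(5)[symmetric] st'(5)[symmetric] by (simp add: algebra_simps)
  then have "?Q (u + s *\<^sub>R v + t *\<^sub>R w) = ?P (u + s' *\<^sub>R w + t' *\<^sub>R v)"
    using \<open>r > 0\<close> by simp
  moreover have "\<bar>?Q (u + s *\<^sub>R v + t *\<^sub>R w) - ?Q u\<bar> < ?\<epsilon>"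
    using d2(2) near[OF st(1-4)] by (simp add: d_def)
  moreover have "\<bar>?P (u + s' *\<^sub>R w + t' *\<^sub>R v) - ?P u\<bar> < ?\<epsilon>"
    using d1(2) near'[OF st'(3,4) st'(1,2)] by (simp add: d_def)
  ultimately show False by (auto simp: abs_real_def split: if_splits)
qed

section \<open>Tangent spaces and the shape operator\<close>

text \<open>Used to see that limits of difference quotients are tangential without knowing that the
  coefficients \<open>z\<close> converge.\<close>

lemma linear_range_limit:
  fixes A :: "'a::euclidean_space \<Rightarrow> 'b::euclidean_space"
  assumes "linear A" "inj A" and "G \<noteq> bot"
    and bound: "eventually (\<lambda>k. norm (A (z k) - y k) \<le> \<epsilon> k * norm (z k)) G"
    and \<epsilon>: "(\<epsilon> \<longlongrightarrow> 0) G" and y: "(y \<longlongrightarrow> l) G"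
  shows "l \<in> range A"
proof -
  obtain c where c: "c > 0" "\<And>x. c * norm x \<le> norm (A x)"
    using linear_inj_bounded_below_pos[OF \<open>linear A\<close> \<open>inj A\<close>] by (metis mult.commute)
  have small: "eventually (\<lambda>k. \<epsilon> k < c / 2) G"
    using order_tendstoD(2)[OF \<epsilon>, of "c / 2"] c by simp
  \<comment> \<open>\<open>A\<close> is bounded below by \<open>c\<close>; once
    \<open>\<epsilon> k < c / 2\<close>, the error is absorbed and \<open>z k\<close> is bounded in
    terms of the convergent \<open>y k\<close>.\<close>
  have "eventually (\<lambda>k. norm (A (z k) - y k) \<le> \<bar>\<epsilon> k\<bar> * (2 / c * norm (y k))) G"
    using bound small
  proof eventually_elim
    case (elim k)
    have "c * norm (z k) \<le> norm (y k) + norm (A (z k) - y k)"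
      using c(2)[of "z k"] norm_triangle_ineq[of "y k" "A (z k) - y k"] by simp
    moreover have "\<epsilon> k * norm (z k) \<le> c / 2 * norm (z k)"
      using elim(2) by (intro mult_right_mono) auto
    ultimately have "c / 2 * norm (z k) \<le> norm (y k)"
      using elim(1) by (simp add: field_simps)
    then have "norm (z k) \<le> 2 / c * norm (y k)"
      using c(1) by (simp add: field_simps)
    moreover have "\<epsilon> k * norm (z k) \<le> \<bar>\<epsilon> k\<bar> * norm (z k)"
      by (intro mult_right_mono) auto
    ultimately show ?case
      using elim(1) by (meson abs_ge_zero mult_left_mono order_trans)
  qed
  moreover have "((\<lambda>k. \<bar>\<epsilon> k\<bar> * (2 / c * norm (y k))) \<longlongrightarrow> \<bar>0\<bar> * (2 / c * norm l)) G"
    by (intro tendsto_intros \<epsilon> y)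
  then have "((\<lambda>k. \<bar>\<epsilon> k\<bar> * (2 / c * norm (y k))) \<longlongrightarrow> 0) G"
    by simp
  ultimately have "((\<lambda>k. A (z k) - y k) \<longlongrightarrow> 0) G"
    by (rule Lim_null_comparison)
  from tendsto_add[OF this y] have lim: "((\<lambda>k. A (z k)) \<longlongrightarrow> l) G" by simp
  have "closed (range A)"
    using \<open>linear A\<close> by (intro closed_subspace linear_subspace_image) auto
  then show ?thesis
    by (rule Lim_in_closed_set[of _ "\<lambda>k. A (z k)" G]) (simp_all add: \<open>G \<noteq> bot\<close> lim)
qed

lemma difference_quotient_tendsto:
  assumes "f differentiable at u"
  shows "((\<lambda>t::real. (f (u + t *\<^sub>R v) - f u) /\<^sub>R t) \<longlongrightarrow> frechet_derivative f (at u) v) (at 0)"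
proof -
  have "((\<lambda>t. f (u + t *\<^sub>R v)) has_derivative (\<lambda>t. frechet_derivative f (at u) (t *\<^sub>R v))) (at 0)"
    by (rule has_derivative_compose[where f = "\<lambda>t. u + t *\<^sub>R v" and x = 0, simplified])
       (use assms in \<open>auto intro!: derivative_eq_intros simp: frechet_derivative_works\<close>)
  moreover have "linear (frechet_derivative f (at u))"
    using assms by (simp add: linear_frechet_derivative)
  ultimately have lim: "((\<lambda>t. norm (f (u + t *\<^sub>R v) - f u - t *\<^sub>R frechet_derivative f (at u) v) / norm t) \<longlongrightarrow> 0) (at 0)"
    by (simp add: has_derivative_at linear_cmul)
  have eq: "norm (f (u + t *\<^sub>R v) - f u - t *\<^sub>R frechet_derivative f (at u) v) / norm t =
      norm ((f (u + t *\<^sub>R v) - f u) /\<^sub>R t - frechet_derivative f (at u) v)" if "t \<noteq> 0" for t :: real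
  proof -
    have "(f (u + t *\<^sub>R v) - f u) /\<^sub>R t - frechet_derivative f (at u) v =
        inverse t *\<^sub>R (f (u + t *\<^sub>R v) - f u - t *\<^sub>R frechet_derivative f (at u) v)"
      using that by (simp add: scaleR_diff_right)
    then show ?thesis by (simp add: divide_inverse mult.commute)
  qed
  have "((\<lambda>t. norm ((f (u + t *\<^sub>R v) - f u) /\<^sub>R t - frechet_derivative f (at u) v)) \<longlongrightarrow> 0) (at 0)"
    by (rule Lim_transform_eventually[OF lim]) (use eq in \<open>auto simp: eventually_at_filter intro!: always_eventually\<close>)
  then have "((\<lambda>t. (f (u + t *\<^sub>R v) - f u) /\<^sub>R t - frechet_derivative f (at u) v) \<longlongrightarrow> 0) (at 0)"
    by (rule tendsto_norm_zero_cancel)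
  then show ?thesis by (rule LIM_zero_cancel)
qed

text \<open>The filter is \<open>nhds 0\<close>, as the increments inserted later may vanish; the
  quotient is then 0 because division by 0 gives 0.\<close>

lemma has_derivative_remainder:
  assumes "f differentiable at u"
  shows "((\<lambda>k. norm (f (u + k) - f u - frechet_derivative f (at u) k) / norm k) \<longlongrightarrow> 0) (nhds 0)"
proof -
  have "((\<lambda>k. norm (f (u + k) - f u - frechet_derivative f (at u) k) / norm k) \<longlongrightarrow> 0) (at 0)"
    using assms by (simp add: frechet_derivative_works has_derivative_at)
  then show ?thesis by (simp add: tendsto_nhds_iff)
qed

lemma local_param_derivative:
  assumes "local_param M F U \<psi>" "u \<in> U"
  shows "linear (frechet_derivative (F \<circ> \<psi>) (at u))" "inj (frechet_derivative (F \<circ> \<psi>) (at u))"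
    "(F \<circ> \<psi>) differentiable at u"
proof -
  show d: "(F \<circ> \<psi>) differentiable at u"
    using assms smooth_on_differentiable(1) unfolding local_param_def by blast
  show "linear (frechet_derivative (F \<circ> \<psi>) (at u))"
    using d by (rule linear_frechet_derivative)
  show "inj (frechet_derivative (F \<circ> \<psi>) (at u))"
    using assms unfolding local_param_def by blast
qed

text \<open>The transition map \<open>\<tau>\<close> is used only as a continuous map. The
  difference quotients of \<open>F \<circ> \<psi>2\<close> equal the images under \<open>?D\<close>
  of those of \<open>\<tau>\<close>, up to an error that is small relative to the latter, so
  \<open>linear_range_limit\<close> puts their limit into the range of \<open>?D\<close>.\<close>

lemma range_derivative_subset:
  fixes F :: "'a::topological_space \<Rightarrow> 'n::finite affine_space"
  assumes 1: "local_param M F U1 \<psi>1" "u1 \<in> U1" and 2: "local_param M F U2 \<psi>2" "u2 \<in> U2"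
    and p: "\<psi>1 u1 = \<psi>2 u2"
  shows "range (frechet_derivative (F \<circ> \<psi>2) (at u2)) \<subseteq> range (frechet_derivative (F \<circ> \<psi>1) (at u1))"
proof
  fix y assume "y \<in> range (frechet_derivative (F \<circ> \<psi>2) (at u2))"
  then obtain v where y: "y = frechet_derivative (F \<circ> \<psi>2) (at u2) v" by auto
  let ?D = "frechet_derivative (F \<circ> \<psi>1) (at u1)"
  obtain \<phi>1 where \<phi>1: "homeomorphism U1 (\<psi>1 ` U1) \<psi>1 \<phi>1"
    using 1 unfolding local_param_def by blast
  obtain \<phi>2 where \<phi>2: "homeomorphism U2 (\<psi>2 ` U2) \<psi>2 \<phi>2"
    using 2 unfolding local_param_def by blast
  have "open U2" and M: "openin (top_of_set M) (\<psi>1 ` U1)" "\<psi>2 ` U2 \<subseteq> M"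
    using 1 2 openin_subset unfolding local_param_def by fastforce+
  have "continuous_on U2 \<psi>2" using \<phi>2 by (simp add: homeomorphism_def)
  obtain Q where Q: "open Q" "\<psi>1 ` U1 = M \<inter> Q"
    using M(1) by (auto simp: openin_open)
  define V where "V = {x \<in> U2. \<psi>2 x \<in> Q}"
  have "open V"
    using continuous_open_preimage[OF \<open>continuous_on U2 \<psi>2\<close> \<open>open U2\<close> Q(1)]
    by (simp add: V_def vimage_def Int_def)
  have V: "\<psi>2 x \<in> \<psi>1 ` U1" "x \<in> U2" if "x \<in> V" for x
    using that M(2) Q(2) by (auto simp: V_def)
  have "\<psi>1 u1 \<in> \<psi>1 ` U1" using 1(2) by (rule imageI)
  then have "u2 \<in> V" using Q(2) p 2(2) by (simp add: V_def)
  define \<tau> where "\<tau> x = \<phi>1 (\<psi>2 x)" for x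
  have "continuous_on V \<tau>"
    unfolding \<tau>_def
    by (rule continuous_on_compose2[of "\<psi>1 ` U1" \<phi>1])
       (use \<phi>1 \<open>continuous_on U2 \<psi>2\<close> V in \<open>auto simp: homeomorphism_def intro: continuous_on_subset\<close>)
  then have "isCont \<tau> u2"
    using \<open>open V\<close> \<open>u2 \<in> V\<close> by (simp add: continuous_on_eq_continuous_at)
  have \<tau>u2: "\<tau> u2 = u1"
    using \<phi>1 1(2) p unfolding \<tau>_def homeomorphism_def by metis
  have \<psi>\<tau>: "\<psi>1 (\<tau> x) = \<psi>2 x" if "x \<in> V" for x
    using \<phi>1 V(1)[OF that] unfolding \<tau>_def homeomorphism_def by metis
  define k where "k t = \<tau> (u2 + t *\<^sub>R v) - u1" for t
  define r where "r k = norm ((F \<circ> \<psi>1) (u1 + k) - (F \<circ> \<psi>1) u1 - ?D k) / norm k" for k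
  have line: "((\<lambda>t. u2 + t *\<^sub>R v) \<longlongrightarrow> u2) (at 0)"
    by (auto intro!: tendsto_eq_intros)
  have "((\<lambda>t. \<tau> (u2 + t *\<^sub>R v)) \<longlongrightarrow> \<tau> u2) (at 0)"
    using \<open>isCont \<tau> u2\<close> line by (rule isCont_tendsto_compose)
  then have "(k \<longlongrightarrow> 0) (at 0)"
    unfolding k_def \<tau>u2 by (rule LIM_zero)
  moreover have "(r \<longlongrightarrow> 0) (nhds 0)"
    unfolding r_def by (rule has_derivative_remainder[OF local_param_derivative(3)[OF 1]])
  ultimately have r: "((\<lambda>t. r (k t)) \<longlongrightarrow> 0) (at 0)"
    by (rule filterlim_compose[rotated])
  have "eventually (\<lambda>t. u2 + t *\<^sub>R v \<in> V) (at 0)"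
    using topological_tendstoD[OF line \<open>open V\<close> \<open>u2 \<in> V\<close>] .
  moreover have "eventually (\<lambda>t. t \<noteq> 0) (at (0::real))"
    by (simp add: eventually_at_filter)
  ultimately have bound: "eventually (\<lambda>t. norm (?D (k t /\<^sub>R t)
      - ((F \<circ> \<psi>2) (u2 + t *\<^sub>R v) - (F \<circ> \<psi>2) u2) /\<^sub>R t) \<le> r (k t) * norm (k t /\<^sub>R t)) (at 0)"
  proof eventually_elim
    case (elim t)
    have F: "(F \<circ> \<psi>2) (u2 + t *\<^sub>R v) = (F \<circ> \<psi>1) (u1 + k t)" "(F \<circ> \<psi>2) u2 = (F \<circ> \<psi>1) u1"
      using \<psi>\<tau>[OF elim(1)] p by (simp_all add: k_def)
    have D: "?D (k t /\<^sub>R t) = ?D (k t) /\<^sub>R t" "?D 0 = 0"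
      using local_param_derivative(1)[OF 1] by (simp_all add: linear_cmul linear_0)
    have "norm (?D (k t) - ((F \<circ> \<psi>1) (u1 + k t) - (F \<circ> \<psi>1) u1)) = r (k t) * norm (k t)"
      by (cases "k t = 0") (simp_all add: r_def D norm_minus_commute)
    then show ?case
      unfolding F D(1) scaleR_diff_right[symmetric] norm_scaleR by simp
  qed
  show "y \<in> range ?D"
    unfolding y
    by (rule linear_range_limit[OF local_param_derivative(1,2)[OF 1] _ bound r
        difference_quotient_tendsto[OF local_param_derivative(3)[OF 2], of v]]) simp
qed

text \<open>The union over all parametrizations in \<open>tangent_space\<close> collapses to the
  range belonging to any one of them.\<close>

lemma tangent_space_eq:
  fixes F :: "'a::topological_space \<Rightarrow> 'n::finite affine_space"
  assumes "local_param M F U \<psi>" "u \<in> U"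
  shows "tangent_space M F (\<psi> u) = range (frechet_derivative (F \<circ> \<psi>) (at u))"
proof
  show "tangent_space M F (\<psi> u) \<subseteq> range (frechet_derivative (F \<circ> \<psi>) (at u))"
    unfolding tangent_space_def using range_derivative_subset[OF assms] by fastforce
  show "range (frechet_derivative (F \<circ> \<psi>) (at u)) \<subseteq> tangent_space M F (\<psi> u)"
    unfolding tangent_space_def using assms by blast
qed

text \<open>An operator bound by values on the basis: convergence of derivatives on each basis
  vector becomes uniform.\<close>

lemma linear_sum_norm_bound:
  fixes A :: "'a::euclidean_space \<Rightarrow> 'b::real_normed_vector"
  assumes "linear A"
  shows "norm (A z) \<le> (\<Sum>b\<in>Basis. norm (A b)) * norm z"
proof -
  have "A z = A (\<Sum>b\<in>Basis. (z \<bullet> b) *\<^sub>R b)"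
    by (simp add: euclidean_representation)
  also have "\<dots> = (\<Sum>b\<in>Basis. (z \<bullet> b) *\<^sub>R A b)"
    using assms by (simp add: linear_sum linear_cmul)
  also have "norm \<dots> \<le> (\<Sum>b\<in>Basis. norm ((z \<bullet> b) *\<^sub>R A b))"
    by (rule norm_sum)
  also have "\<dots> \<le> (\<Sum>b\<in>Basis. norm (A b) * norm z)"
    using mult_right_mono[OF Basis_le_norm norm_ge_zero] by (intro sum_mono) (simp add: mult.commute[of "norm (A _)"])
  finally show ?thesis by (simp add: sum_distrib_right)
qed

text \<open>The product rule modulo tangent vectors, with no differentiability of the coefficient
  field \<open>z\<close>. The unknown increments of \<open>z\<close> only produce tangential
  terms.\<close>

lemma derivative_tangential_field:
  fixes f g :: "'a::euclidean_space \<Rightarrow> 'b::euclidean_space"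
  assumes f: "smooth_on U f" and "open U" "u \<in> U" and inj: "inj (frechet_derivative f (at u))"
    and g: "g differentiable at u"
    and tangential: "\<And>x. x \<in> U \<Longrightarrow> g x = frechet_derivative f (at x) (z x)"
  shows "frechet_derivative g (at u) w - second_derivative f u w (z u)
    \<in> range (frechet_derivative f (at u))"
proof -
  let ?D = "\<lambda>x. frechet_derivative f (at x)"
  have lin: "linear (?D x)" if "x \<in> U" for x
    using smooth_on_differentiable(1)[OF f that] by (rule linear_frechet_derivative)
  define x where "x t = u + t *\<^sub>R w" for t :: real
  define \<epsilon> where "\<epsilon> t = (\<Sum>b\<in>Basis. norm (?D u b - ?D (x t) b))" for t
  have x: "(x \<longlongrightarrow> u) (at 0)"
    unfolding x_def by (auto intro!: tendsto_eq_intros)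
  have D: "((\<lambda>t. ?D (x t) b) \<longlongrightarrow> ?D u b) (at 0)" for b
  proof (rule isCont_tendsto_compose[OF _ x])
    show "isCont (\<lambda>x. ?D x b) u"
      using smooth_on_differentiable(2)[OF f \<open>u \<in> U\<close>] by (rule differentiable_imp_continuous_within)
  qed
  have "(\<epsilon> \<longlongrightarrow> (\<Sum>b\<in>Basis. norm (?D u b - ?D u b))) (at 0)"
    unfolding \<epsilon>_def by (intro tendsto_intros D)
  then have \<epsilon>: "(\<epsilon> \<longlongrightarrow> 0) (at 0)" by simp
  define y where "y t = (g (x t) - g u) /\<^sub>R t - (?D (x t) (z u) - ?D u (z u)) /\<^sub>R t" for t
  have y: "(y \<longlongrightarrow> frechet_derivative g (at u) w - second_derivative f u w (z u)) (at 0)"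
    unfolding y_def x_def second_derivative_def
    by (intro tendsto_diff difference_quotient_tendsto g smooth_on_differentiable(2)[OF f \<open>u \<in> U\<close>])
  have "eventually (\<lambda>t. x t \<in> U) (at 0)"
    using topological_tendstoD[OF x \<open>open U\<close> \<open>u \<in> U\<close>] .
  then have bound: "eventually (\<lambda>t. norm (?D u ((z (x t) - z u) /\<^sub>R t) - y t)
      \<le> \<epsilon> t * norm ((z (x t) - z u) /\<^sub>R t)) (at 0)"
  proof eventually_elim
    case (elim t)
    have "y t = ?D (x t) ((z (x t) - z u) /\<^sub>R t)"
      using tangential[OF elim] tangential[OF \<open>u \<in> U\<close>] lin[OF elim]
      by (simp add: y_def linear_cmul linear_diff algebra_simps)
    then have "?D u ((z (x t) - z u) /\<^sub>R t) - y t = (\<lambda>v. ?D u v - ?D (x t) v) ((z (x t) - z u) /\<^sub>R t)"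
      by simp
    also have "norm \<dots> \<le> \<epsilon> t * norm ((z (x t) - z u) /\<^sub>R t)"
      unfolding \<epsilon>_def
      by (rule linear_sum_norm_bound) (intro linear_compose_sub lin elim \<open>u \<in> U\<close>)
    finally show ?case .
  qed
  show ?thesis
    by (rule linear_range_limit[OF lin[OF \<open>u \<in> U\<close>] inj _ bound \<epsilon> y]) simp
qed

section \<open>Orthonormal bases\<close>

text \<open>Induction on the dimension. Unless \<open>T\<close> is zero, polarization yields a
  vector with \<open>h X0 X0\<close> nonzero. It is normalized to square 1 or -1 and split off; its
  orthogonal complement \<open>T'\<close> is again nondegenerate, since \<open>T\<close> is spanned
  by \<open>T'\<close> and \<open>X\<close>.\<close>

lemma exists_orthonormal_set:
  fixes T :: "'v::euclidean_space set" and h :: "'v tensor2"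
  assumes "subspace T"
    and sym: "\<And>X Y. X \<in> T \<Longrightarrow> Y \<in> T \<Longrightarrow> h X Y = h Y X"
    and add: "\<And>X Y Z. X \<in> T \<Longrightarrow> Y \<in> T \<Longrightarrow> Z \<in> T \<Longrightarrow> h (X + Y) Z = h X Z + h Y Z"
    and scale: "\<And>c X Z. X \<in> T \<Longrightarrow> Z \<in> T \<Longrightarrow> h (c *\<^sub>R X) Z = c * h X Z"
    and "nondegenerate_on T h"
  shows "\<exists>B. independent B \<and> span B = T \<and> (\<forall>b\<in>B. h b b = 1 \<or> h b b = -1) \<and>
    (\<forall>b\<in>B. \<forall>c\<in>B. b \<noteq> c \<longrightarrow> h b c = 0)"
  using assms
proof (induction "dim T" arbitrary: T rule: less_induct)
  case less
  note T = \<open>subspace T\<close> and sym = less.prems(2) and add = less.prems(3) and scale = less.prems(4)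
  note closed = subspace_add[OF T] subspace_scale[OF T] subspace_0[OF T]
  have add_right: "h Z (X + Y) = h Z X + h Z Y" if "X \<in> T" "Y \<in> T" "Z \<in> T" for X Y Z
    using that sym[of Z] add[of X Y Z] closed by simp
  have scale_right: "h Z (c *\<^sub>R X) = c * h Z X" if "X \<in> T" "Z \<in> T" for X Z c
    using that sym[of Z] scale[of X Z c] closed by simp
  show ?case
  proof (cases "\<forall>X\<in>T. h X X = 0")
    case True
    have "h X Y = 0" if "X \<in> T" "Y \<in> T" for X Y
      using True[rule_format, of "X + Y"] True[rule_format, of X] True[rule_format, of Y] that closed
      by (simp add: add add_right sym[of Y X])
    then have "X = 0" if "X \<in> T" for X
      using \<open>nondegenerate_on T h\<close> that unfolding nondegenerate_on_def by blast
    then have "T = {0}" using closed by auto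
    then show ?thesis by (intro exI[of _ "{}"]) (simp add: dependent_def)
  next
    case False
    then obtain X0 where X0: "X0 \<in> T" "h X0 X0 \<noteq> 0" by blast
    define X where "X = (1 / sqrt \<bar>h X0 X0\<bar>) *\<^sub>R X0"
    have X: "X \<in> T" using X0 closed by (simp add: X_def)
    have "h X X = h X0 X0 / (sqrt \<bar>h X0 X0\<bar> * sqrt \<bar>h X0 X0\<bar>)"
      using X0 closed by (simp add: X_def scale scale_right)
    then have "h X X = h X0 X0 / \<bar>h X0 X0\<bar>" by simp
    then have hX: "h X X = 1 \<or> h X X = -1" using X0(2) by (auto simp: abs_real_def)
    define T' where "T' = {Y \<in> T. h X Y = 0}"
    have sub: "T' \<subseteq> T" by (auto simp: T'_def)
    have "h X 0 = 0" using scale_right[of 0 X 0] X closed by simp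
    then have T': "subspace T'"
      using closed X by (auto simp: T'_def subspace_def add_right scale_right)
    have proj: "Z + (- h X Z / h X X) *\<^sub>R X \<in> T'" if "Z \<in> T" for Z
    proof -
      have "Z + (- h X Z / h X X) *\<^sub>R X \<in> T"
        using that X by (intro closed)
      moreover have "h X (Z + (- h X Z / h X X) *\<^sub>R X) = 0"
        unfolding add_right[OF that closed(2)[OF X] X] scale_right[OF X X] using hX by auto
      ultimately show ?thesis by (simp add: T'_def)
    qed
    have "nondegenerate_on T' h"
      unfolding nondegenerate_on_def
    proof (intro ballI impI)
      fix Y assume Y: "Y \<in> T'" "\<forall>Z\<in>T'. h Y Z = 0"
      have "h Y Z = 0" if "Z \<in> T" for Z
      proof -
        have "Y \<in> T" "h Y X = 0" using Y(1) X sym[of Y X] by (auto simp: T'_def)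
        then show ?thesis
          using Y(2)[rule_format, OF proj[OF that]] add_right[OF that closed(2)[OF X] \<open>Y \<in> T\<close>]
            scale_right[OF X \<open>Y \<in> T\<close>] by (metis add.right_neutral mult_zero_right)
      qed
      then show "Y = 0"
        using \<open>nondegenerate_on T h\<close> Y(1) sub unfolding nondegenerate_on_def by blast
    qed
    have "X \<notin> T'" using hX by (auto simp: T'_def)
    then have "dim T' < dim T"
      using sub X T T' by (intro dim_psubset) (auto simp: span_eq_iff[THEN iffD2])
    moreover have "h X Y = h Y X" if "X \<in> T'" "Y \<in> T'" for X Y
      by (rule sym) (use that sub in auto)
    moreover have "h (X + Y) Z = h X Z + h Y Z" if "X \<in> T'" "Y \<in> T'" "Z \<in> T'" for X Y Z
      by (rule add) (use that sub in auto)
    moreover have "h (c *\<^sub>R X) Z = c * h X Z" if "X \<in> T'" "Z \<in> T'" for c X Z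
      by (rule scale) (use that sub in auto)
    ultimately have "\<exists>B. independent B \<and> span B = T' \<and> (\<forall>b\<in>B. h b b = 1 \<or> h b b = -1) \<and>
        (\<forall>b\<in>B. \<forall>c\<in>B. b \<noteq> c \<longrightarrow> h b c = 0)"
      by (rule less.hyps[OF _ T' _ _ _ \<open>nondegenerate_on T' h\<close>])
    then obtain B where B: "independent B" "span B = T'" "\<forall>b\<in>B. h b b = 1 \<or> h b b = -1"
        "\<forall>b\<in>B. \<forall>c\<in>B. b \<noteq> c \<longrightarrow> h b c = 0"
      by blast
    have "B \<subseteq> T'" using B(2) span_superset by blast
    have "span (insert X B) = T"
    proof
      show "span (insert X B) \<subseteq> T"
        using \<open>B \<subseteq> T'\<close> sub X T by (intro span_minimal) auto
      show "T \<subseteq> span (insert X B)"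
      proof
        fix Z assume "Z \<in> T"
        then have "Z + (- h X Z / h X X) *\<^sub>R X \<in> span (insert X B)"
          using proj B(2) span_mono[of B "insert X B"] by blast
        then show "Z \<in> span (insert X B)"
          using span_add[OF _ span_scale[OF span_base[of X "insert X B"]],
              of "Z + (- h X Z / h X X) *\<^sub>R X" "h X Z / h X X"] by simp
      qed
    qed
    moreover have "independent (insert X B)"
      using B \<open>X \<notin> T'\<close> by (simp add: independent_insertI)
    moreover have "h X b = 0" "h b X = 0" if "b \<in> B" for b
      using that \<open>B \<subseteq> T'\<close> sub X sym[of X b] by (auto simp: T'_def)
    ultimately show ?thesis
      using B hX by (intro exI[of _ "insert X B"]) auto
  qed
qed

lemma exists_orthonormal_basis:
  fixes T :: "'v::euclidean_space set" and h :: "'v tensor2"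
  assumes "subspace T" and "dim T = CARD('n)"
    and "\<And>X Y. X \<in> T \<Longrightarrow> Y \<in> T \<Longrightarrow> h X Y = h Y X"
    and "\<And>X Y Z. X \<in> T \<Longrightarrow> Y \<in> T \<Longrightarrow> Z \<in> T \<Longrightarrow> h (X + Y) Z = h X Z + h Y Z"
    and "\<And>c X Z. X \<in> T \<Longrightarrow> Z \<in> T \<Longrightarrow> h (c *\<^sub>R X) Z = c * h X Z"
    and "nondegenerate_on T h"
  shows "\<exists>e :: 'n::finite \<Rightarrow> 'v. orthonormal_basis_of T h e"
proof -
  obtain B where B: "independent B" "span B = T" "\<forall>b\<in>B. h b b = 1 \<or> h b b = -1"
      "\<forall>b\<in>B. \<forall>c\<in>B. b \<noteq> c \<longrightarrow> h b c = 0"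
    using exists_orthonormal_set[OF assms(1,3-6)] by blast
  have "card B = CARD('n)"
    using B(1,2) assms(2) dim_span_eq_card_independent by metis
  then obtain e :: "'n \<Rightarrow> 'v" where e: "bij_betw e UNIV B"
    using B(1) independent_imp_finite by (metis finite_same_card_bij finite)
  have "orthonormal_basis_of T h e"
    unfolding orthonormal_basis_of_def basis_of_def
    using e B by (auto simp: bij_betw_def inj_eq)
  then show ?thesis by blast
qed

section \<open>The Blaschke structure at a point\<close>

lemma transversal_scale_eq_0:
  assumes "subspace T" "\<zeta> \<notin> T" "c *\<^sub>R \<zeta> \<in> T"
  shows "c = 0"
  using subspace_scale[OF assms(1,3), of "inverse c"] assms(2) by (cases "c = 0") auto

text \<open>Properties of \<open>h\<close> come from comparing components along
  \<open>\<xi> p\<close> in the Gauss formula, using linearity and symmetry of second derivatives.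
  The same comparison for \<open>\<xi>\<close> itself gives the self-adjointness of
  \<open>\<S>\<close>.\<close>

lemma blaschke_structure_at:
  fixes M :: "'a::{t2_space, second_countable_topology} set"
    and F :: "'a \<Rightarrow> 'n::finite affine_space"
  assumes M: "nondegenerate_hypersurface M F" and \<xi>: "affine_normal M F \<xi> h"
    and \<S>: "affine_shape_operator M F \<xi> \<S>" and "p \<in> M"
  defines "T \<equiv> tangent_space M F p"
  shows "subspace T" and "dim T = CARD('n)" and "nondegenerate_on T (h p)"
    and "\<And>X Y. X \<in> T \<Longrightarrow> Y \<in> T \<Longrightarrow> h p X Y = h p Y X"
    and "\<And>X Y Z. X \<in> T \<Longrightarrow> Y \<in> T \<Longrightarrow> Z \<in> T \<Longrightarrow> h p (X + Y) Z = h p X Z + h p Y Z"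
    and "\<And>c X Z. X \<in> T \<Longrightarrow> Z \<in> T \<Longrightarrow> h p (c *\<^sub>R X) Z = c * h p X Z"
    and "\<And>X. X \<in> T \<Longrightarrow> \<S> p X \<in> T"
    and "\<And>X Y. X \<in> T \<Longrightarrow> Y \<in> T \<Longrightarrow> h p X (\<S> p Y) = h p Y (\<S> p X)"
proof -
  have "hypersurface M F" using M unfolding nondegenerate_hypersurface_def by blast
  then obtain U \<psi> where \<psi>: "local_param M F U \<psi>" "p \<in> \<psi> ` U"
    using \<open>p \<in> M\<close> unfolding hypersurface_def by blast
  note \<psi> = \<psi>(1) and im = \<psi>(2)
  obtain u where u: "u \<in> U" "\<psi> u = p"
    using im by blast
  let ?f = "F \<circ> \<psi>"
  let ?D = "frechet_derivative ?f (at u)"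
  have U: "open U" and f: "smooth_on U ?f" using \<psi> unfolding local_param_def by auto
  note D = local_param_derivative[OF \<psi> u(1)]
  have T: "T = range ?D" using tangent_space_eq[OF \<psi> u(1)] u(2) by (simp add: T_def)
  show subT: "subspace T" unfolding T using D(1) by (simp add: linear_subspace_image)
  show "dim T = CARD('n)" unfolding T using D(1,2) by (simp add: dim_image_eq)
  have \<xi>p: "\<xi> p \<notin> T"
    using \<xi> \<open>p \<in> M\<close> unfolding affine_normal_def transversal_field_def T_def by blast
  have h: "affine_fundamental_form_at M F p (\<xi> p) (h p)"
    using \<xi> \<open>p \<in> M\<close> unfolding affine_normal_def by blast
  show "nondegenerate_on T (h p)"
    using M h \<xi>p \<open>p \<in> M\<close> unfolding nondegenerate_hypersurface_def T_def by blast
  have gauss: "second_derivative ?f u v w - h p (?D v) (?D w) *\<^sub>R \<xi> p \<in> T" for v w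
    using h \<psi> u unfolding affine_fundamental_form_at_def T_def by blast
  have unique: "c = d" if "x - c *\<^sub>R \<xi> p \<in> T" "x - d *\<^sub>R \<xi> p \<in> T" for c d x
    using transversal_scale_eq_0[OF subT \<xi>p, of "d - c"] subspace_diff[OF subT that]
    by (simp add: scaleR_diff_left)
  have lin: "linear (\<lambda>v. second_derivative ?f u v w)" for w
    unfolding second_derivative_def
    using smooth_on_differentiable(2)[OF f u(1)] by (rule linear_frechet_derivative)
  show "h p X Y = h p Y X" if XY: "X \<in> T" "Y \<in> T" for X Y
  proof -
    obtain v w where X: "X = ?D v" "Y = ?D w" using XY unfolding T by blast
    show ?thesis
      using unique[OF gauss[of v w]] gauss[of w v] second_derivative_commute[OF f U u(1), of v w]
      unfolding X by simp
  qed
  show "h p (X + Y) Z = h p X Z + h p Y Z" if XY: "X \<in> T" "Y \<in> T" "Z \<in> T" for X Y Z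
  proof -
    obtain v w x where X: "X = ?D v" "Y = ?D w" "Z = ?D x" using XY unfolding T by blast
    have "second_derivative ?f u (v + w) x - (h p X Z + h p Y Z) *\<^sub>R \<xi> p \<in> T"
      using subspace_add[OF subT gauss[of v x] gauss[of w x]]
      by (simp add: X linear_add[OF lin] algebra_simps)
    then show ?thesis
      using unique[OF gauss[of "v + w" x]] D(1) by (simp add: X linear_add)
  qed
  show "h p (c *\<^sub>R X) Z = c * h p X Z" if XY: "X \<in> T" "Z \<in> T" for c X Z
  proof -
    obtain v x where X: "X = ?D v" "Z = ?D x" using XY unfolding T by blast
    have "second_derivative ?f u (c *\<^sub>R v) x - (c * h p X Z) *\<^sub>R \<xi> p \<in> T"
      using subspace_scale[OF subT gauss[of v x], of c]
      by (simp add: X linear_cmul[OF lin] algebra_simps)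
    then show ?thesis
      using unique[OF gauss[of "c *\<^sub>R v" x]] D(1) by (simp add: X linear_cmul)
  qed
  have weingarten: "\<S> (\<psi> x) (frechet_derivative ?f (at x) v) \<in> tangent_space M F (\<psi> x)"
    "frechet_derivative (\<xi> \<circ> \<psi>) (at x) v = - \<S> (\<psi> x) (frechet_derivative ?f (at x) v)"
    if "x \<in> U" for x v
    using \<S> \<psi> that unfolding affine_shape_operator_def by blast+
  show "\<S> p X \<in> T" if "X \<in> T" for X
    using weingarten(1)[OF u(1)] that u(2) T unfolding T_def by auto
  have \<xi>\<psi>: "smooth_on U (\<xi> \<circ> \<psi>)"
    using \<xi> \<psi> unfolding affine_normal_def transversal_field_def by blast
  \<comment> \<open>The field \<open>- \<S> Y\<close> is differentiated again; its component along
    \<open>\<xi> p\<close> is given by the Gauss formula. The coordinates \<open>z\<close> of this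
    field are merely chosen pointwise, hence \<open>derivative_tangential_field\<close>.\<close>
  have normal: "second_derivative (\<xi> \<circ> \<psi>) u w v - (- h p (?D w) (\<S> p (?D v))) *\<^sub>R \<xi> p \<in> T" for v w
  proof -
    let ?g = "\<lambda>x. frechet_derivative (\<xi> \<circ> \<psi>) (at x) v"
    have "\<exists>z. ?g x = frechet_derivative ?f (at x) (- z)" if x: "x \<in> U" for x
    proof -
      obtain z where z: "\<S> (\<psi> x) (frechet_derivative ?f (at x) v) = frechet_derivative ?f (at x) z"
        using weingarten(1)[OF x, of v] tangent_space_eq[OF \<psi> x] by auto
      show ?thesis
        using weingarten(2)[OF x, of v] z local_param_derivative(1)[OF \<psi> x]
        by (auto simp: linear_neg)
    qed
    then obtain z where z: "\<And>x. x \<in> U \<Longrightarrow> ?g x = frechet_derivative ?f (at x) (- z x)"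
      by metis
    have "?D (z u) = \<S> p (?D v)"
      using z[OF u(1)] weingarten(2)[OF u(1), of v] u(2) D(1) by (simp add: linear_neg)
    moreover have "second_derivative (\<xi> \<circ> \<psi>) u w v - second_derivative ?f u w (- z u) \<in> T"
      using derivative_tangential_field[OF f U u(1) D(2) smooth_on_differentiable(2)[OF \<xi>\<psi> u(1)] z, where w = w]
      by (simp add: T second_derivative_def)
    moreover have "second_derivative ?f u w (- z u) - h p (?D w) (?D (- z u)) *\<^sub>R \<xi> p \<in> T"
      by (rule gauss)
    moreover have "h p (?D w) (?D (- z u)) = - h p (?D w) (?D (z u))"
    proof -
      \<comment> \<open>\<open>lin\<close> concerns the first direction only, so the sign is moved
        out after exchanging the directions.\<close>
      have "second_derivative ?f u w (- z u) - (- h p (?D w) (?D (z u))) *\<^sub>R \<xi> p \<in> T"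
        using subspace_scale[OF subT gauss[of "z u" w], of "-1"]
          second_derivative_commute[OF f U u(1), of w]
          unique[OF gauss[of w "z u"]] gauss[of "z u" w]
        by (simp add: linear_neg[OF lin] algebra_simps)
      then show ?thesis using unique[OF gauss[of w "- z u"]] by simp
    qed
    ultimately show ?thesis
      using subspace_add[OF subT] by fastforce
  qed
  show "h p X (\<S> p Y) = h p Y (\<S> p X)" if XY: "X \<in> T" "Y \<in> T" for X Y
  proof -
    obtain v w where X: "X = ?D v" "Y = ?D w" using XY unfolding T by blast
    have "second_derivative (\<xi> \<circ> \<psi>) u v w = second_derivative (\<xi> \<circ> \<psi>) u w v"
      by (rule second_derivative_commute[OF \<xi>\<psi> U u(1)])
    then have "- h p X (\<S> p Y) = - h p Y (\<S> p X)"
      unfolding X using unique[OF normal[of w v]] normal[of v w] by metis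
    then show ?thesis by simp
  qed
qed

section \<open>The theorem at a point\<close>

text \<open>If all 2-minors vanish, every row is a multiple of the row through a nonzero entry, so
  the row rank is at most one.\<close>

lemma rank_ge_2_imp_minor:
  fixes G :: "real^'n^'n"
  assumes "rank G \<ge> 2"
  shows "\<exists>i j k l. G $ i $ k * G $ j $ l - G $ i $ l * G $ j $ k \<noteq> 0"
proof (rule ccontr)
  assume "\<not> ?thesis"
  then have minors: "G $ i $ k * G $ j $ l = G $ i $ l * G $ j $ k" for i j k l by simp
  have "\<exists>r. rows G \<subseteq> span {r}"
  proof (cases "G = 0")
    case True
    then have "rows G \<subseteq> span {0}" by (auto simp: rows_def row_def vec_eq_iff)
    then show ?thesis by blast
  next
    case False
    then obtain a b where ab: "G $ a $ b \<noteq> 0" by (auto simp: vec_eq_iff)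
    have row: "row i G = (G $ i $ b / G $ a $ b) *\<^sub>R row a G" for i
      using ab minors[of i _ a b] by (auto simp: row_def vec_eq_iff field_simps)
    have "row i G \<in> span {row a G}" for i
      unfolding row[of i] by (intro span_scale span_base) simp
    then have "rows G \<subseteq> span {row a G}"
      by (auto simp: rows_def)
    then show ?thesis by blast
  qed
  then obtain r where "rows G \<subseteq> span {r}" by blast
  then have "dim (rows G) \<le> dim {r}"
    using dim_subset[of "rows G" "span {r}"] by simp
  also have "\<dots> \<le> 1" using dim_le_card'[of "{r}"] by simp
  finally show False using assms by (simp add: row_rank_def)
qed

lemma tensor_rank_ge_2_imp_minor2:
  fixes T :: "'n::finite affine_space set"
  assumes "tensor_rank T a \<ge> 2" and basis: "basis_of T (e :: 'n \<Rightarrow> 'n affine_space)"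
  shows "\<exists>X1\<in>T. \<exists>X2\<in>T. \<exists>X3\<in>T. \<exists>X4\<in>T. minor2 a X1 X2 X3 X4 \<noteq> 0"
proof -
  define f where "f = (SOME f :: 'n \<Rightarrow> 'n affine_space. basis_of T f)"
  have "basis_of T f" unfolding f_def by (rule someI[of "basis_of T", OF basis])
  then have f: "f i \<in> T" for i
    unfolding basis_of_def by (metis rangeI span_base)
  have "rank (\<chi> i j. a (f i) (f j)) \<ge> 2"
    using assms(1) by (simp add: tensor_rank_def f_def Let_def)
  from rank_ge_2_imp_minor[OF this] show ?thesis
    using f by (auto simp: minor2_def) blast
qed

text \<open>\<open>frame\<close> ties \<open>e\<close> to the very choice made inside
  \<open>Ricci\<close> and \<open>scalar_curvature\<close>, so both unfold to sums over
  \<open>e\<close> without a change of basis.\<close>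

locale OV_point = self_adjoint_frame T h e A
  for T :: "'n::finite affine_space set" and h :: "'n affine_space tensor2"
    and e :: "'n \<Rightarrow> 'n affine_space" and A +
  fixes n :: real
  assumes frame: "e = (SOME e. orthonormal_basis_of T h e)"
    and dim: "n = real CARD('n)" "n \<ge> 4"
    and U_Ric: "\<not> eq2_on T (Ricci T h (OV_curvature h A))
      (\<lambda>X Y. scalar_curvature T h (OV_curvature h A) / n * h X Y)"
    and U_Weyl: "\<not> eq4_on T (Weyl T h (OV_curvature h A)) (\<lambda>X1 X2 X3 X4. 0)"
    and rank: "\<And>\<rho>. tensor_rank T (\<lambda>X Y. Ricci T h (OV_curvature h A) X Y - \<rho> * h X Y) \<ge> 2"
begin

sublocale ric: self_adjoint_frame T h e Ricci_operator
  by (rule Ricci_frame)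

abbreviation R where "R \<equiv> OV_curvature h A"

lemma Ricci_eq: "X \<in> T \<Longrightarrow> Y \<in> T \<Longrightarrow> Ricci T h R X Y = Ricci_form X Y"
  using Ricci_trace_OV_curvature[of X Y] by (simp add: Ricci_def Ricci_trace_def Let_def flip: frame)

lemma scalar_curvature_eq: "scalar_curvature T h R = ric.trace"
  using Ricci_eq by (simp add: scalar_curvature_def ric.trace_def Let_def flip: frame)

text \<open>Tracing \<open>Ric = c h\<close> identifies \<open>c\<close> as the scalar curvature
  over \<open>n\<close>, the case that \<open>U_Ric\<close> excludes.\<close>

lemma not_Einstein: "\<nexists>c. \<forall>X\<in>T. \<forall>Y\<in>T. Ricci_form X Y = c * h X Y"
proof
  assume "\<exists>c. \<forall>X\<in>T. \<forall>Y\<in>T. Ricci_form X Y = c * h X Y"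
  then obtain c where c: "\<And>X Y. X \<in> T \<Longrightarrow> Y \<in> T \<Longrightarrow> Ricci_form X Y = c * h X Y" by blast
  have "ric.trace = (\<Sum>j\<in>UNIV. c * (h (e j) (e j) * h (e j) (e j)))"
    unfolding ric.trace_def by (rule sum.cong) (simp_all add: c)
  then have "ric.trace = c * n" by (simp add: frame_sign dim)
  then show False
    using U_Ric dim c by (auto simp: eq2_on_def scalar_curvature_eq Ricci_eq)
qed

lemma Weyl_eq:
  "eq4_on T (Weyl T h R) (\<lambda>X1 X2 X3 X4. R X1 X2 X3 X4
      - 1 / (n - 2) * kulkarni_nomizu h Ricci_form X1 X2 X3 X4
      + ric.trace / (2 * (n - 2) * (n - 1)) * kulkarni_nomizu h h X1 X2 X3 X4)"
  by (simp add: eq4_on_def Weyl_def Let_def scalar_curvature_eq kulkarni_nomizu_def Ricci_eq dim)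

text \<open>The locale is entered with the Ricci operator in place of the shape operator.\<close>

lemma quadratic_curvatureI:
  assumes "eq4_on T R (quadratic_tensor h Ricci_form \<phi> \<mu> \<eta>)"
  shows "quadratic_curvature T h e Ricci_operator R (Weyl T h R) \<phi> \<mu> \<eta> n"
  by unfold_locales
     (use assms dim Weyl_eq not_Einstein U_Weyl Ricci_trace_OV_curvature in \<open>auto\<close>)

lemma part_i:
  assumes "eq6_on T (curvature_dot T h R R) (\<lambda>X1 X2 X3 X4 X Y. L * tachibana h R X1 X2 X3 X4 X Y)"
  shows "\<exists>\<phi>. eq4_on T R (\<lambda>X1 X2 X3 X4. \<phi> / 2 *
      kulkarni_nomizu (\<lambda>X Y. Ricci T h R X Y - L * h X Y) (\<lambda>X Y. Ricci T h R X Y - L * h X Y) X1 X2 X3 X4)"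
    and "eq6_on T
      (\<lambda>X1 X2 X3 X4 X Y. curvature_dot T h (Weyl T h R) R X1 X2 X3 X4 X Y
        - curvature_dot T h R (Weyl T h R) X1 X2 X3 X4 X Y)
      (\<lambda>X1 X2 X3 X4 X Y. tachibana (Ricci T h R) (Weyl T h R) X1 X2 X3 X4 X Y
        - scalar_curvature T h R / (n - 1) * tachibana h (Weyl T h R) X1 X2 X3 X4 X Y)"
proof -
  have "basis_of T e" using orthonormal by (simp add: orthonormal_basis_of_def)
  from tensor_rank_ge_2_imp_minor2[OF rank[of 0] this]
  obtain V1 V2 V3 V4 where V: "V1 \<in> T" "V2 \<in> T" "V3 \<in> T" "V4 \<in> T"
      "minor2 Ricci_form V1 V2 V3 V4 \<noteq> 0"
    by (auto simp: minor2_def Ricci_eq)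
  obtain \<phi> where \<phi>: "eq4_on T R (\<lambda>X1 X2 X3 X4. \<phi> / 2 *
    kulkarni_nomizu (\<lambda>X Y. Ricci_form X Y - L * h X Y) (\<lambda>X Y. Ricci_form X Y - L * h X Y) X1 X2 X3 X4)"
    using curvature_from_pseudosymmetry[OF assms not_Einstein V] by blast
  then have "eq4_on T R (\<lambda>X1 X2 X3 X4. \<phi> / 2 *
      kulkarni_nomizu (\<lambda>X Y. Ricci T h R X Y - L * h X Y) (\<lambda>X Y. Ricci T h R X Y - L * h X Y) X1 X2 X3 X4)"
    by (simp add: eq4_on_def kulkarni_nomizu_def Ricci_eq)
  then show "\<exists>\<phi>. eq4_on T R (\<lambda>X1 X2 X3 X4. \<phi> / 2 *
      kulkarni_nomizu (\<lambda>X Y. Ricci T h R X Y - L * h X Y) (\<lambda>X Y. Ricci T h R X Y - L * h X Y) X1 X2 X3 X4)"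
    by blast
  \<comment> \<open>The square of \<open>Ric - L h\<close> is multiplied out to reach the form
    required by \<open>Weyl_dot_identity\<close>.\<close>
  have "eq4_on T R (quadratic_tensor h Ricci_form \<phi> (- \<phi> * L) (\<phi> * L\<^sup>2))"
    unfolding eq4_on_def
  proof (intro ballI)
    fix X1 X2 X3 X4 assume "X1 \<in> T" "X2 \<in> T" "X3 \<in> T" "X4 \<in> T"
    then have "R X1 X2 X3 X4 = \<phi> / 2 * kulkarni_nomizu (\<lambda>X Y. Ricci_form X Y - L * h X Y)
        (\<lambda>X Y. Ricci_form X Y - L * h X Y) X1 X2 X3 X4"
      using \<phi> by (simp add: eq4_on_def)
    also have "\<dots> = quadratic_tensor h Ricci_form \<phi> (- \<phi> * L) (\<phi> * L\<^sup>2) X1 X2 X3 X4"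
      by (simp add: quadratic_tensor_def kulkarni_nomizu_def algebra_simps power2_eq_square)
    finally show "R X1 X2 X3 X4 = quadratic_tensor h Ricci_form \<phi> (- \<phi> * L) (\<phi> * L\<^sup>2) X1 X2 X3 X4" .
  qed
  then interpret quadratic_curvature T h e Ricci_operator R "Weyl T h R" \<phi> "- \<phi> * L" "\<phi> * L\<^sup>2" n
    by (rule quadratic_curvatureI)
  show "eq6_on T
      (\<lambda>X1 X2 X3 X4 X Y. curvature_dot T h (Weyl T h R) R X1 X2 X3 X4 X Y
        - curvature_dot T h R (Weyl T h R) X1 X2 X3 X4 X Y)
      (\<lambda>X1 X2 X3 X4 X Y. tachibana (Ricci T h R) (Weyl T h R) X1 X2 X3 X4 X Y
        - scalar_curvature T h R / (n - 1) * tachibana h (Weyl T h R) X1 X2 X3 X4 X Y)"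
    unfolding eq6_on_def scalar_curvature_eq
    by (intro ballI Weyl_dot_identity[where L = L]) (simp_all add: eq2_on_def Ricci_eq)
qed

lemma part_ii:
  assumes "eq4_on T R (\<lambda>X1 X2 X3 X4.
     \<phi> / 2 * kulkarni_nomizu (Ricci T h R) (Ricci T h R) X1 X2 X3 X4
     + \<mu> * kulkarni_nomizu h (Ricci T h R) X1 X2 X3 X4
     + \<eta> / 2 * kulkarni_nomizu h h X1 X2 X3 X4)"
  shows "eq6_on T (curvature_dot T h R R)
    (\<lambda>X1 X2 X3 X4 X Y. ((n - 2) * (\<mu>\<^sup>2 - \<phi> * \<eta>) - \<mu>) * inverse \<phi> * tachibana h R X1 X2 X3 X4 X Y)"
proof -
  have "eq4_on T R (quadratic_tensor h Ricci_form \<phi> \<mu> \<eta>)"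
    using assms by (simp add: eq4_on_def quadratic_tensor_def kulkarni_nomizu_def Ricci_eq)
  then interpret quadratic_curvature T h e Ricci_operator R "Weyl T h R" \<phi> \<mu> \<eta> n
    by (rule quadratic_curvatureI)
  show ?thesis unfolding eq6_on_def by (intro ballI pseudosymmetry)
qed

end

theorem theorem6p5:
  fixes M :: "'a::{t2_space, second_countable_topology} set"
    and F :: "'a \<Rightarrow> 'n::finite affine_space"
    and \<xi> :: "'a \<Rightarrow> 'n affine_space"
    and h :: "'a \<Rightarrow> 'n affine_space tensor2"
    and \<S> :: "'a \<Rightarrow> 'n affine_space \<Rightarrow> 'n affine_space"
    and T :: "'a \<Rightarrow> 'n affine_space set"
    and R :: "'a \<Rightarrow> 'n affine_space tensor4"
    and Ric :: "'a \<Rightarrow> 'n affine_space tensor2"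
    and \<kappa> :: "'a \<Rightarrow> real"
    and W :: "'a \<Rightarrow> 'n affine_space tensor4"
    and \<U> :: "'a set"
    and n :: real
  assumes n_ge_4: "CARD('n) \<ge> 4"
    and hypersurface: "nondegenerate_hypersurface M F"
    and normal: "affine_normal M F \<xi> h"
    and shape: "affine_shape_operator M F \<xi> \<S>"
    and "n = real CARD('n)"
    and "T = tangent_space M F"
    and "R = (\<lambda>p. OV_curvature (h p) (\<S> p))"
    and "Ric = (\<lambda>p. Ricci (T p) (h p) (R p))"
    and "\<kappa> = (\<lambda>p. scalar_curvature (T p) (h p) (R p))"
    and "W = (\<lambda>p. Weyl (T p) (h p) (R p))"
    and "\<U> = {p \<in> U_Ricci M F h R \<inter> U_Weyl M F h R.
                \<forall>\<rho>::real. tensor_rank (T p) (\<lambda>X Y. Ric p X Y - \<rho> * h p X Y) \<ge> 2}"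
  shows
    "(\<forall>L :: 'a \<Rightarrow> real.
       (\<forall>p\<in>\<U>. eq6_on (T p) (curvature_dot (T p) (h p) (R p) (R p))
          (\<lambda>X1 X2 X3 X4 X Y. L p * tachibana (h p) (R p) X1 X2 X3 X4 X Y))
       \<longrightarrow>
       (\<forall>p\<in>\<U>. eq6_on (T p)
          (\<lambda>X1 X2 X3 X4 X Y.
             curvature_dot (T p) (h p) (W p) (R p) X1 X2 X3 X4 X Y
             - curvature_dot (T p) (h p) (R p) (W p) X1 X2 X3 X4 X Y)
          (\<lambda>X1 X2 X3 X4 X Y.
             tachibana (Ric p) (W p) X1 X2 X3 X4 X Y
             - \<kappa> p / (n - 1) * tachibana (h p) (W p) X1 X2 X3 X4 X Y)) \<and>
       (\<exists>\<phi> :: 'a \<Rightarrow> real. \<forall>p\<in>\<U>. eq4_on (T p) (R p)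
          (\<lambda>X1 X2 X3 X4.
             \<phi> p / 2 * kulkarni_nomizu (\<lambda>X Y. Ric p X Y - L p * h p X Y)
                                       (\<lambda>X Y. Ric p X Y - L p * h p X Y) X1 X2 X3 X4)))
     \<and>
     (\<forall>\<phi> \<mu> \<eta> :: 'a \<Rightarrow> real.
       (\<forall>p\<in>\<U>. eq4_on (T p) (R p)
          (\<lambda>X1 X2 X3 X4.
             \<phi> p / 2 * kulkarni_nomizu (Ric p) (Ric p) X1 X2 X3 X4
             + \<mu> p * kulkarni_nomizu (h p) (Ric p) X1 X2 X3 X4
             + \<eta> p / 2 * kulkarni_nomizu (h p) (h p) X1 X2 X3 X4))
       \<longrightarrow>
       (\<forall>p\<in>\<U>. eq6_on (T p) (curvature_dot (T p) (h p) (R p) (R p))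
          (\<lambda>X1 X2 X3 X4 X Y.
             ((n - 2) * ((\<mu> p)\<^sup>2 - \<phi> p * \<eta> p) - \<mu> p) * inverse (\<phi> p)
             * tachibana (h p) (R p) X1 X2 X3 X4 X Y)))"
proof -
  define e :: "'a \<Rightarrow> 'n \<Rightarrow> 'n affine_space"
    where "e p = (SOME e. orthonormal_basis_of (T p) (h p) e)" for p
  have point: "OV_point (T p) (h p) (e p) (\<S> p) n" if "p \<in> \<U>" for p
  proof -
    have p: "p \<in> M" "p \<in> U_Ricci M F h R" "p \<in> U_Weyl M F h R"
      using that assms(11) by (auto simp: U_Ricci_def)
    have T: "T p = tangent_space M F p" using assms(6) by simp
    note struct = blaschke_structure_at[OF hypersurface normal shape p(1), folded T]
    have "\<exists>e :: 'n \<Rightarrow> 'n affine_space. orthonormal_basis_of (T p) (h p) e"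
      by (rule exists_orthonormal_basis[OF struct(1,2,4,5,6,3)])
    then have "orthonormal_basis_of (T p) (h p) (e p)"
      unfolding e_def by (rule someI_ex)
    then show ?thesis
      using that p struct(4-8) n_ge_4 assms(5,11)
      by unfold_locales
         (simp_all add: e_def T U_Ricci_def U_Weyl_def assms(7,8))
  qed
  show ?thesis
  proof (intro conjI allI impI)
    fix L :: "'a \<Rightarrow> real"
    assume L: "\<forall>p\<in>\<U>. eq6_on (T p) (curvature_dot (T p) (h p) (R p) (R p))
          (\<lambda>X1 X2 X3 X4 X Y. L p * tachibana (h p) (R p) X1 X2 X3 X4 X Y)"
    show "\<forall>p\<in>\<U>. eq6_on (T p)
          (\<lambda>X1 X2 X3 X4 X Y.
             curvature_dot (T p) (h p) (W p) (R p) X1 X2 X3 X4 X Y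
             - curvature_dot (T p) (h p) (R p) (W p) X1 X2 X3 X4 X Y)
          (\<lambda>X1 X2 X3 X4 X Y.
             tachibana (Ric p) (W p) X1 X2 X3 X4 X Y
             - \<kappa> p / (n - 1) * tachibana (h p) (W p) X1 X2 X3 X4 X Y)"
      using OV_point.part_i(2)[OF point] L unfolding assms(7-10) by blast
    \<comment> \<open>A number \<open>\<phi>\<close> exists at each point; choice assembles these
      into a function.\<close>
    have "\<forall>p\<in>\<U>. \<exists>\<phi>. eq4_on (T p) (R p) (\<lambda>X1 X2 X3 X4. \<phi> / 2 *
        kulkarni_nomizu (\<lambda>X Y. Ric p X Y - L p * h p X Y) (\<lambda>X Y. Ric p X Y - L p * h p X Y)
          X1 X2 X3 X4)"
      using OV_point.part_i(1)[OF point] L unfolding assms(7,8) by blast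
    then show "\<exists>\<phi> :: 'a \<Rightarrow> real. \<forall>p\<in>\<U>. eq4_on (T p) (R p) (\<lambda>X1 X2 X3 X4. \<phi> p / 2 *
        kulkarni_nomizu (\<lambda>X Y. Ric p X Y - L p * h p X Y) (\<lambda>X Y. Ric p X Y - L p * h p X Y)
          X1 X2 X3 X4)"
      by (rule bchoice)
  next
    fix \<phi> \<mu> \<eta> :: "'a \<Rightarrow> real"
    assume R: "\<forall>p\<in>\<U>. eq4_on (T p) (R p)
          (\<lambda>X1 X2 X3 X4.
             \<phi> p / 2 * kulkarni_nomizu (Ric p) (Ric p) X1 X2 X3 X4
             + \<mu> p * kulkarni_nomizu (h p) (Ric p) X1 X2 X3 X4
             + \<eta> p / 2 * kulkarni_nomizu (h p) (h p) X1 X2 X3 X4)"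
    show "\<forall>p\<in>\<U>. eq6_on (T p) (curvature_dot (T p) (h p) (R p) (R p))
          (\<lambda>X1 X2 X3 X4 X Y.
             ((n - 2) * ((\<mu> p)\<^sup>2 - \<phi> p * \<eta> p) - \<mu> p) * inverse (\<phi> p)
             * tachibana (h p) (R p) X1 X2 X3 X4 X Y)"
      using OV_point.part_ii[OF point] R unfolding assms(7,8) by blast
  qed
qed

end
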